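(* Let $\Phi=(\phi_1,\dots,\phi_K)$ be a unit norm tight frame in $\mathbb{R}^d$ with frame constant $A=K/d$ and coherence $\mu$. Let signals $y_n=\Phi x_n+r_n$, $n=1,\dots,N$, be i.i.d., where $r_n$ is independent of $x_n$ with $\|r_n\|_2\le\rho_{\max}$ a.s., $\mathbb{E}(r_n)=0$, $\mathbb{E}(r_nr_n^\star)=\rho^2I$, and $x_n$ is drawn from a symmetric probability distribution $\nu$ on $S^{K-1}$ with $\mathbb{E}_x\|x\|_\infty^2=\bar c_1^2$. Assume there is $\beta<1/2$ with $$\nu\Big(\frac{c_2(x)+\mu\|c(x)\|_1+\rho_{\max}}{c_1(x)-c_2(x)}\le\beta\Big)=1.$$ Let $\lambda:=\bar c_1^2-\frac{1-\bar c_1^2}{K-1}$ and $C_L:=(\sqrt A+\rho_{\max})^2$. If for some $0<q<1/4$ the number of samples satisfies $$N^{-q}+N^{-2q}/K\le\frac{(1-2\beta)^2}{4A\log(4AK/\lambda)},$$ then, except with probability $\exp\Big(\frac{-N^{1-4q}\lambda^2}{4K^2C_L}+Kd\log(NKC_L/\lambda)\Big)$, there is a local maximum $\tilde\Psi$ of $$\max_{\Psi\in\mathcal D}\frac1N\sum_{n=1}^N\|\Psi^\star y_n\|_\infty^2$$ (equivalently a local minimum of $\min_{\Psi\in\mathcal D,\,X\in\mathcal X_1}\|Y-\Psi X\|_F^2$) with $\max_k\|\tilde\psi_k-\phi_k\|_2\le2N^{-q}$.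
   Context: $\mathcal D$ is the set of dictionaries $\Psi=(\psi_1,\dots,\psi_K)$, $\psi_i\in\mathbb{R}^d$, $\|\psi_i\|_2=1$. $Y=(y_1,\dots,y_N)$, $\mathcal X_S$ is the set of $K\times N$ matrices whose columns each have at most $S$ nonzero entries, $\|\cdot\|_F$ the Frobenius norm. Unit norm tight frame with frame constant $A$: $\sum_i|\langle\phi_i,v\rangle|^2=A\|v\|_2^2$; coherence $\mu=\max_{i\ne j}|\langle\phi_i,\phi_j\rangle|$. Symmetric measure on $S^{K-1}$: invariant under coordinate sign flips and permutations. $c_1(x)\ge\dots\ge c_K(x)$ is the non-increasing rearrangement of $(|x_i|)_i$, $c(x)$ the resulting vector. *)

theory Defs
  imports "HOL-Probability.Probability"
begin

text \<open>Vectors of R^d and R^K are modelled as real^'d and real^'k with finite index types;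
  d = CARD('d), K = CARD('k). A dictionary is a map 'k => real^'d.\<close>

definition unit_norm_tight_frame :: "('k::finite \<Rightarrow> real^'d::finite) \<Rightarrow> real \<Rightarrow> bool" where
  "unit_norm_tight_frame \<Phi> A \<longleftrightarrow>
     (\<forall>i. norm (\<Phi> i) = 1) \<and> (\<forall>v. (\<Sum>i\<in>UNIV. (\<Phi> i \<bullet> v)^2) = A * (norm v)^2)"

definition coherence :: "('k::finite \<Rightarrow> real^'d::finite) \<Rightarrow> real" where
  "coherence \<Phi> = Max {\<bar>\<Phi> i \<bullet> \<Phi> j\<bar> | i j. i \<noteq> j}"

definition dictionaries :: "('k::finite \<Rightarrow> real^'d::finite) set" where
  "dictionaries = {\<Psi>. \<forall>k. norm (\<Psi> k) = 1}"

definition synth :: "('k::finite \<Rightarrow> real^'d::finite) \<Rightarrow> real^'k \<Rightarrow> real^'d" where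
  "synth \<Phi> x = (\<Sum>k\<in>UNIV. x $ k *\<^sub>R \<Phi> k)"

definition analysis_op :: "('k::finite \<Rightarrow> real^'d::finite) \<Rightarrow> real^'d \<Rightarrow> real^'k" where
  "analysis_op \<Psi> y = (\<chi> k. \<Psi> k \<bullet> y)"

definition linf_norm :: "real^'k::finite \<Rightarrow> real" where
  "linf_norm x = Max (range (\<lambda>i. \<bar>x $ i\<bar>))"

text \<open>j-th entry (1-indexed, 1 <= j <= K) of the non-increasing rearrangement of (|x_i|)_i.\<close>
definition rearr :: "real^'k::finite \<Rightarrow> nat \<Rightarrow> real" where
  "rearr x j = Max {t \<in> range (\<lambda>i. \<bar>x $ i\<bar>). j \<le> card {i. t \<le> \<bar>x $ i\<bar>}}"

definition rearr_l1 :: "real^'k::finite \<Rightarrow> real" where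
  "rearr_l1 x = (\<Sum>j=1..CARD('k). rearr x j)"

definition symmetric_measure :: "(real^'k::finite) measure \<Rightarrow> bool" where
  "symmetric_measure \<nu> \<longleftrightarrow>
     (\<forall>s::real^'k. (\<forall>i. s $ i = 1 \<or> s $ i = -1) \<longrightarrow>
         distr \<nu> borel (\<lambda>x. \<chi> i. s $ i * x $ i) = \<nu>) \<and>
     (\<forall>p. p permutes (UNIV::'k set) \<longrightarrow> distr \<nu> borel (\<lambda>x. \<chi> i. x $ p i) = \<nu>)"

definition emp_objective :: "nat \<Rightarrow> (nat \<Rightarrow> real^'d::finite) \<Rightarrow> ('k::finite \<Rightarrow> real^'d) \<Rightarrow> real" where
  "emp_objective N y \<Psi> = (1 / real N) * (\<Sum>n<N. (linf_norm (analysis_op \<Psi> (y n)))^2)"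

definition local_max_on_dict ::
  "(('k::finite \<Rightarrow> real^'d::finite) \<Rightarrow> real) \<Rightarrow> ('k \<Rightarrow> real^'d) \<Rightarrow> bool" where
  "local_max_on_dict F \<Psi>0 \<longleftrightarrow> \<Psi>0 \<in> dictionaries \<and>
     (\<exists>\<epsilon>>0. \<forall>\<Psi>\<in>dictionaries. (\<forall>k. dist (\<Psi> k) (\<Psi>0 k) < \<epsilon>) \<longrightarrow> F \<Psi> \<le> F \<Psi>0)"

end

theory Submission
  imports Defs
begin

text \<open>The gap condition makes the coefficient of largest modulus determine the atom with the largest
  correlation, not only for \<open>\<Phi>\<close> but for all dictionaries within some distance \<open>r \<le> 2 N powr - q\<close> of
  it. In that neighbourhood the objective therefore decouples into one quadratic form per atom. By
  the symmetry of \<open>\<nu>\<close> and the tight frame identity, the form of atom \<open>k\<close> has expectation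
  \<open>(\<lambda> \<langle>\<phi>\<^sub>k, \<psi>\<rangle>\<^sup>2 + const \<parallel>\<psi>\<parallel>\<^sup>2) / K\<close>, so on the unit sphere it drops by \<open>(\<lambda> / K) (1 - \<langle>\<phi>\<^sub>k, \<psi>\<rangle>\<^sup>2)\<close>
  when \<open>\<phi>\<^sub>k\<close> is replaced by \<open>\<psi>\<close>. A Bernstein bound on a net of the sphere of radius \<open>r\<close> around \<open>\<phi>\<^sub>k\<close>
  shows that the empirical form does not exceed its value at \<open>\<phi>\<^sub>k\<close> there, whence it has a maximum
  inside the cap. The variance carries a factor \<open>1 / K\<close>, because atom \<open>k\<close> is dominant with that
  probability; this is what makes the tail small enough even though \<open>r\<close> may be of order \<open>1 / \<surd>K\<close>.\<close>

section \<open>Separated coefficient vectors\<close>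

lemma rearr_ge:
  fixes x :: "real^'k::finite"
  assumes "j \<le> card {l. \<bar>x $ i\<bar> \<le> \<bar>x $ l\<bar>}"
  shows "\<bar>x $ i\<bar> \<le> rearr x j"
  unfolding rearr_def using assms by (intro Max_ge) auto

lemma rearr_1_attained:
  fixes x :: "real^'k::finite"
  obtains i where "rearr x 1 = \<bar>x $ i\<bar>"
proof -
  let ?S = "{t \<in> range (\<lambda>i. \<bar>x $ i\<bar>). 1 \<le> card {i. t \<le> \<bar>x $ i\<bar>}}"
  fix i0 :: 'k
  have "card {l. \<bar>x $ i0\<bar> \<le> \<bar>x $ l\<bar>} \<ge> 1"
    using card_gt_0_iff[of "{l. \<bar>x $ i0\<bar> \<le> \<bar>x $ l\<bar>}"] by fastforce
  then have "\<bar>x $ i0\<bar> \<in> ?S" by auto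
  then have "Max ?S \<in> ?S" by (intro Max_in) auto
  then show ?thesis using that unfolding rearr_def by auto
qed

lemma abs_le_rearr_1: "\<bar>x $ i\<bar> \<le> rearr (x :: real^'k::finite) 1"
proof (rule rearr_ge)
  show "1 \<le> card {l. \<bar>x $ i\<bar> \<le> \<bar>x $ l\<bar>}"
    using card_gt_0_iff[of "{l. \<bar>x $ i\<bar> \<le> \<bar>x $ l\<bar>}"] by fastforce
qed

text \<open>The indices i and j both carry a modulus of at least |x_j|, so two entries reach that
  level.\<close>

lemma abs_le_rearr_2:
  fixes x :: "real^'k::finite"
  assumes "rearr x 1 = \<bar>x $ i\<bar>" "j \<noteq> i"
  shows "\<bar>x $ j\<bar> \<le> rearr x 2"
proof (rule rearr_ge)
  have "{i, j} \<subseteq> {l. \<bar>x $ j\<bar> \<le> \<bar>x $ l\<bar>}"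
    using abs_le_rearr_1[of x j] assms by auto
  from card_mono[OF _ this] show "2 \<le> card {l. \<bar>x $ j\<bar> \<le> \<bar>x $ l\<bar>}"
    using assms by auto
qed

text \<open>Sorting the indices by decreasing modulus matches each entry with a rearranged value at
  least as large. Ties are harmless because an inequality suffices.\<close>

lemma sum_abs_le_rearr_l1: "(\<Sum>i\<in>UNIV. \<bar>x $ i\<bar>) \<le> rearr_l1 (x :: real^'k::finite)"
proof -
  obtain us :: "'k list" where us: "set us = UNIV" "distinct us"
    using finite_distinct_list[of "UNIV :: 'k set"] by auto
  define xs where "xs = sort_key (\<lambda>i. - \<bar>x $ i\<bar>) us"
  have xs: "set xs = UNIV" "distinct xs" using us by (auto simp: xs_def)
  have len: "length xs = CARD('k)" using distinct_card[OF xs(2)] xs(1) by simp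
  have srt: "sorted (map (\<lambda>i. - \<bar>x $ i\<bar>) xs)" by (simp add: xs_def)
  \<comment> \<open>The p + 1 indices listed up to position p all have modulus at least that at
    position p. Positions count from 0, \<open>rearr\<close> from 1.\<close>
  have ge: "\<bar>x $ (xs ! p)\<bar> \<le> rearr x (Suc p)" if p: "p < CARD('k)" for p
  proof (rule rearr_ge)
    have "(!) xs ` {..p} \<subseteq> {l. \<bar>x $ (xs ! p)\<bar> \<le> \<bar>x $ l\<bar>}"
    proof clarsimp
      fix i assume "i \<le> p"
      then show "\<bar>x $ (xs ! p)\<bar> \<le> \<bar>x $ (xs ! i)\<bar>"
        using sorted_nth_mono[OF srt, of i p] p len by simp
    qed
    from card_mono[OF _ this]
    have "card ((!) xs ` {..p}) \<le> card {l. \<bar>x $ (xs ! p)\<bar> \<le> \<bar>x $ l\<bar>}" by simp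
    moreover have "card ((!) xs ` {..p}) = Suc p"
      using inj_on_nth[OF xs(2), of "{..p}"] p len by (subst card_image) auto
    ultimately show "Suc p \<le> card {l. \<bar>x $ (xs ! p)\<bar> \<le> \<bar>x $ l\<bar>}" by simp
  qed
  have "(\<Sum>i\<in>UNIV. \<bar>x $ i\<bar>) = (\<Sum>p<CARD('k). \<bar>x $ (xs ! p)\<bar>)"
    using bij_betw_nth[OF xs(2) refl refl] xs(1) len
    by (intro sum.reindex_bij_betw[symmetric]) simp
  also have "\<dots> \<le> (\<Sum>p<CARD('k). rearr x (Suc p))" by (intro sum_mono ge) simp
  also have "\<dots> = rearr_l1 x" unfolding rearr_l1_def
    by (rule sum.reindex_bij_witness[of _ "\<lambda>j. j - 1" Suc]) auto
  finally show ?thesis .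
qed

text \<open>The number \<open>t\<close> plays the part of c_2: it may be any bound on the remaining
  moduli, which removes the rearrangement from the later estimates. The last conjunct is the gap
  condition with its denominator cleared.\<close>

definition separated :: "real \<Rightarrow> real \<Rightarrow> real \<Rightarrow> real^'k::finite \<Rightarrow> 'k \<Rightarrow> bool" where
  "separated \<mu> \<rho> \<beta> x k \<longleftrightarrow> norm x = 1 \<and> (\<exists>t. 0 \<le> t \<and> t < \<bar>x $ k\<bar> \<and> (\<forall>j. j \<noteq> k \<longrightarrow> \<bar>x $ j\<bar> \<le> t) \<and>
     t + \<mu> * (\<Sum>j\<in>UNIV. \<bar>x $ j\<bar>) + \<rho> \<le> \<beta> * (\<bar>x $ k\<bar> - t))"

text \<open>Strictness makes these sets open and pairwise disjoint, so that their indicators split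
  expectations and the objective atom by atom.\<close>

definition dominant :: "'k::finite \<Rightarrow> (real^'k) set" where
  "dominant k = {x. \<forall>j. j \<noteq> k \<longrightarrow> \<bar>x $ j\<bar> < \<bar>x $ k\<bar>}"

lemma separated_if_gap:
  fixes x :: "real^'k::finite"
  assumes "CARD('k) \<ge> 2" "0 \<le> \<mu>" "norm x = 1" "rearr x 2 < rearr x 1"
    and "(rearr x 2 + \<mu> * rearr_l1 x + \<rho>) / (rearr x 1 - rearr x 2) \<le> \<beta>"
  shows "\<exists>k. separated \<mu> \<rho> \<beta> x k"
proof -
  obtain i where i: "rearr x 1 = \<bar>x $ i\<bar>" by (rule rearr_1_attained)
  \<comment> \<open>A second index is required for c_2 to bound an actual modulus and hence be
    nonnegative; with a single index \<open>rearr x 2\<close> would be the maximum of an empty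
    set.\<close>
  have "UNIV \<noteq> {i}"
  proof
    assume "UNIV = {i}"
    then have "CARD('k) = 1" by (metis card_1_singleton_iff One_nat_def)
    then show False using assms(1) by simp
  qed
  then obtain j where "j \<noteq> i" by blast
  then have "0 \<le> rearr x 2" using abs_le_rearr_2[OF i, of j] by linarith
  moreover have "rearr x 2 + \<mu> * rearr_l1 x + \<rho> \<le> \<beta> * (rearr x 1 - rearr x 2)"
    using assms(4,5) by (simp add: pos_divide_le_eq)
  moreover have "\<mu> * (\<Sum>j\<in>UNIV. \<bar>x $ j\<bar>) \<le> \<mu> * rearr_l1 x"
    using sum_abs_le_rearr_l1 assms(2) by (rule mult_left_mono)
  ultimately show ?thesis unfolding separated_def
    using assms(3,4) i abs_le_rearr_2[OF i] by (intro exI[of _ i] conjI exI[of _ "rearr x 2"]) auto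
qed

lemma norm_square_vec: "(norm (x :: real^'k::finite))\<^sup>2 = (\<Sum>j\<in>UNIV. (x $ j)\<^sup>2)"
  by (simp add: norm_vec_def L2_set_def sum_nonneg)

context
  fixes \<mu> \<rho> \<beta> :: real and x :: "real^'k::finite" and k :: 'k
  assumes sep: "separated \<mu> \<rho> \<beta> x k" and nn: "0 \<le> \<mu>" "0 \<le> \<rho>" and beta: "\<beta> < 1/2"
begin

lemma separated_dominant: "x \<in> dominant k"
  using sep unfolding separated_def dominant_def by fastforce

lemma separated_beta_nonneg: "0 \<le> \<beta>"
proof -
  obtain t where "0 \<le> t" "t < \<bar>x $ k\<bar>" "t + \<mu> * (\<Sum>j\<in>UNIV. \<bar>x $ j\<bar>) + \<rho> \<le> \<beta> * (\<bar>x $ k\<bar> - t)"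
    using sep unfolding separated_def by auto
  moreover have "0 \<le> \<mu> * (\<Sum>j\<in>UNIV. \<bar>x $ j\<bar>)" using nn by (simp add: sum_nonneg)
  ultimately have "0 \<le> \<beta> * (\<bar>x $ k\<bar> - t)" using nn by linarith
  then show ?thesis using \<open>t < \<bar>x $ k\<bar>\<close> by (simp add: zero_le_mult_iff)
qed

lemma separated_max_le_1: "\<bar>x $ k\<bar> \<le> 1"
  using sep component_le_norm_cart[of x k] unfolding separated_def by auto

text \<open>The right side of the gap inequality is at most half of |x_k| since \<beta> < 1/2 and t
  \<ge> 0.\<close>

lemma separated_interference: "\<mu> * (\<Sum>j\<in>UNIV. \<bar>x $ j\<bar>) + \<rho> \<le> \<bar>x $ k\<bar> / 2"
proof -
  obtain t where t: "0 \<le> t" "t < \<bar>x $ k\<bar>" "t + \<mu> * (\<Sum>j\<in>UNIV. \<bar>x $ j\<bar>) + \<rho> \<le> \<beta> * (\<bar>x $ k\<bar> - t)"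
    using sep unfolding separated_def by auto
  have "\<beta> * (\<bar>x $ k\<bar> - t) \<le> 1/2 * \<bar>x $ k\<bar>"
    using beta t separated_beta_nonneg by (intro mult_mono) auto
  then show ?thesis using t by linarith
qed

lemma separated_noise_le: "\<rho> \<le> 1/2"
proof -
  have "0 \<le> \<mu> * (\<Sum>j\<in>UNIV. \<bar>x $ j\<bar>)" using nn by (simp add: sum_nonneg)
  then show ?thesis using separated_interference separated_max_le_1 by linarith
qed

text \<open>The gap inequality yields t \<le> (|x_k| - t) / 2, which rearranges to 3 t \<le>
  |x_k|.\<close>

lemma separated_second_le:
  assumes "0 \<le> t" "t < \<bar>x $ k\<bar>" "t + \<mu> * (\<Sum>j\<in>UNIV. \<bar>x $ j\<bar>) + \<rho> \<le> \<beta> * (\<bar>x $ k\<bar> - t)"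
  shows "t \<le> \<bar>x $ k\<bar> / 3"
proof -
  have "0 \<le> \<mu> * (\<Sum>j\<in>UNIV. \<bar>x $ j\<bar>)" using nn by (simp add: sum_nonneg)
  then have "t \<le> \<beta> * (\<bar>x $ k\<bar> - t)" using assms nn by linarith
  also have "\<dots> \<le> 1/2 * (\<bar>x $ k\<bar> - t)"
    using beta assms by (intro mult_right_mono) auto
  finally show ?thesis by simp
qed

text \<open>With K = CARD('k), all other squares are at most a ninth of
  \<open>(x $ k)\<^sup>2\<close>, so unit norm gives 1 \<le> (1 + (K - 1) / 9) times that square.
  For K \<ge> 2 the gain over the trivial bound 1 / K makes \<lambda> strictly positive
  later.\<close>

lemma separated_max_ge: "9 / (real CARD('k) + 8) \<le> (x $ k)\<^sup>2"
proof -
  obtain t where t: "0 \<le> t" "t < \<bar>x $ k\<bar>" "\<And>j. j \<noteq> k \<Longrightarrow> \<bar>x $ j\<bar> \<le> t"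
      "t + \<mu> * (\<Sum>j\<in>UNIV. \<bar>x $ j\<bar>) + \<rho> \<le> \<beta> * (\<bar>x $ k\<bar> - t)"
    using sep unfolding separated_def by auto
  have t3: "t \<le> \<bar>x $ k\<bar> / 3" using t(1,2,4) by (rule separated_second_le)
  have "(x $ j)\<^sup>2 \<le> (x $ k)\<^sup>2 / 9" if "j \<noteq> k" for j
  proof -
    have "\<bar>x $ j\<bar> \<le> \<bar>x $ k\<bar> / 3" using t(3)[OF that] t3 by linarith
    from power_mono[OF this, of 2] show ?thesis by (simp add: power_divide)
  qed
  then have "(\<Sum>j\<in>UNIV - {k}. (x $ j)\<^sup>2) \<le> (\<Sum>j\<in>UNIV - {k}. (x $ k)\<^sup>2 / 9)"
    by (intro sum_mono) auto
  also have "\<dots> = (real CARD('k) - 1) * ((x $ k)\<^sup>2 / 9)"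
    by (simp add: card_Diff_singleton of_nat_diff Suc_leI)
  finally have "(\<Sum>j\<in>UNIV - {k}. (x $ j)\<^sup>2) \<le> (real CARD('k) - 1) * ((x $ k)\<^sup>2 / 9)" .
  moreover have "1 = (x $ k)\<^sup>2 + (\<Sum>j\<in>UNIV - {k}. (x $ j)\<^sup>2)"
    using sep norm_square_vec[of x] sum.remove[of UNIV k "\<lambda>j. (x $ j)\<^sup>2"]
    unfolding separated_def by simp
  ultimately have "9 \<le> (real CARD('k) + 8) * (x $ k)\<^sup>2" by (simp add: algebra_simps)
  then show ?thesis by (simp add: pos_divide_le_eq mult.commute)
qed

lemma separated_max_ge_sqrt: "1 / sqrt (real CARD('k)) \<le> \<bar>x $ k\<bar>"
proof -
  have "1 / real CARD('k) \<le> 9 / (real CARD('k) + 8)"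
    by (simp add: field_simps Suc_leI)
  then have "1 / real CARD('k) \<le> (x $ k)\<^sup>2" using separated_max_ge by linarith
  then have "sqrt (1 / real CARD('k)) \<le> sqrt ((x $ k)\<^sup>2)" by (rule real_sqrt_le_mono)
  then show ?thesis by (simp add: real_sqrt_divide)
qed

end

section \<open>Correlations of a signal with the atoms of a tight frame and of nearby
  dictionaries\<close>

lemma inner_synth: "u \<bullet> synth \<Phi> x = (\<Sum>j\<in>UNIV. x $ j * (u \<bullet> \<Phi> j))"
  by (simp add: synth_def inner_sum_right)

lemma abs_inner_le_coherence:
  fixes \<Phi> :: "'k::finite \<Rightarrow> real^'d::finite"
  assumes "i \<noteq> j" shows "\<bar>\<Phi> i \<bullet> \<Phi> j\<bar> \<le> coherence \<Phi>"
proof -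
  have "finite {\<bar>\<Phi> i \<bullet> \<Phi> j\<bar> | i j. i \<noteq> j}"
    by (rule finite_subset[of _ "(\<lambda>(i,j). \<bar>\<Phi> i \<bullet> \<Phi> j\<bar>) ` UNIV"]) auto
  then show ?thesis unfolding coherence_def using assms by (intro Max_ge) auto
qed

lemma unit_norm_tight_frameD:
  assumes "unit_norm_tight_frame \<Phi> A"
  shows "norm (\<Phi> i) = 1" "(\<Sum>i\<in>UNIV. (\<Phi> i \<bullet> v)\<^sup>2) = A * (norm v)\<^sup>2"
  using assms unfolding unit_norm_tight_frame_def by auto

text \<open>Apply the frame identity to an atom: its correlation with itself alone contributes
  1.\<close>

lemma tight_frame_constant_ge_1:
  fixes \<Phi> :: "'k::finite \<Rightarrow> real^'d::finite"
  assumes "unit_norm_tight_frame \<Phi> A" shows "1 \<le> A"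
proof -
  fix k :: 'k
  have "(\<Phi> k \<bullet> \<Phi> k)\<^sup>2 \<le> (\<Sum>i\<in>UNIV. (\<Phi> i \<bullet> \<Phi> k)\<^sup>2)"
    by (rule member_le_sum) auto
  then show ?thesis using unit_norm_tight_frameD[OF assms]
    by (simp add: dot_square_norm)
qed

text \<open>Synthesis is the adjoint of analysis, which has norm sqrt A. Concretely, the squared
  norm of the synthesised vector is a pairing of \<open>x\<close> with its analysis coefficients;
  Cauchy-Schwarz and cancellation of one norm factor finish.\<close>

lemma norm_synth_le:
  fixes \<Phi> :: "'k::finite \<Rightarrow> real^'d::finite"
  assumes "unit_norm_tight_frame \<Phi> A"
  shows "norm (synth \<Phi> x) \<le> sqrt A * norm x"
proof -
  let ?v = "synth \<Phi> x"
  have A: "0 \<le> A" using tight_frame_constant_ge_1[OF assms] by simp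
  have "(norm ?v)\<^sup>2 = (\<Sum>j\<in>UNIV. x $ j * (?v \<bullet> \<Phi> j))"
    by (simp add: inner_synth[symmetric] dot_square_norm)
  also have "\<dots> \<le> (\<Sum>j\<in>UNIV. \<bar>x $ j\<bar> * \<bar>\<Phi> j \<bullet> ?v\<bar>)"
    by (intro sum_mono) (metis abs_ge_self abs_mult inner_commute)
  also have "\<dots> \<le> L2_set (\<lambda>j. x $ j) UNIV * L2_set (\<lambda>j. \<Phi> j \<bullet> ?v) UNIV"
    by (rule L2_set_mult_ineq)
  also have "\<dots> = norm x * (sqrt A * norm ?v)"
    using unit_norm_tight_frameD(2)[OF assms, of ?v] A
    by (simp add: L2_set_def norm_square_vec[of x, symmetric] real_sqrt_mult)
  finally have "norm ?v * norm ?v \<le> (sqrt A * norm x) * norm ?v"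
    by (simp add: power2_eq_square mult_ac)
  then show ?thesis using A by (cases "norm ?v = 0") (auto simp: mult_le_cancel_right)
qed

text \<open>The atom returns its own coefficient exactly; every other coefficient leaks in with
  weight at most the coherence, and the noise adds at most \<rho>.\<close>

lemma abs_inner_frame_signal:
  fixes \<Phi> :: "'k::finite \<Rightarrow> real^'d::finite"
  assumes "unit_norm_tight_frame \<Phi> A" "norm r \<le> \<rho>"
  shows "\<bar>\<Phi> i \<bullet> (synth \<Phi> x + r) - x $ i\<bar> \<le> coherence \<Phi> * (\<Sum>j\<in>UNIV. \<bar>x $ j\<bar>) - coherence \<Phi> * \<bar>x $ i\<bar> + \<rho>"
proof -
  have r: "\<bar>\<Phi> i \<bullet> r\<bar> \<le> \<rho>"
    using Cauchy_Schwarz_ineq2[of "\<Phi> i" r] assms(2) unit_norm_tight_frameD(1)[OF assms(1), of i] by simp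
  have "\<Phi> i \<bullet> synth \<Phi> x = x $ i + (\<Sum>j\<in>UNIV-{i}. x $ j * (\<Phi> i \<bullet> \<Phi> j))"
    unfolding inner_synth using unit_norm_tight_frameD(1)[OF assms(1), of i]
    by (subst sum.remove[of UNIV i]) (auto simp: dot_square_norm)
  moreover have "\<bar>\<Sum>j\<in>UNIV-{i}. x $ j * (\<Phi> i \<bullet> \<Phi> j)\<bar> \<le> (\<Sum>j\<in>UNIV-{i}. \<bar>x $ j\<bar> * coherence \<Phi>)"
    by (rule order_trans[OF sum_abs])
      (auto intro!: sum_mono mult_left_mono abs_inner_le_coherence simp: abs_mult)
  moreover have "(\<Sum>j\<in>UNIV-{i}. \<bar>x $ j\<bar> * coherence \<Phi>) =
      coherence \<Phi> * (\<Sum>j\<in>UNIV. \<bar>x $ j\<bar>) - coherence \<Phi> * \<bar>x $ i\<bar>"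
    by (simp add: sum_distrib_left sum_diff1 mult.commute)
  ultimately show ?thesis using r by (simp add: inner_add_right)
qed

lemma linf_norm_eqI:
  assumes "\<And>j. \<bar>v $ j\<bar> \<le> \<bar>v $ k\<bar>" shows "linf_norm v = \<bar>v $ k\<bar>"
  unfolding linf_norm_def using assms by (intro Max_eqI) auto

context
  fixes \<Phi> :: "'k::finite \<Rightarrow> real^'d::finite" and A \<rho> \<beta> :: real and x :: "real^'k" and k :: 'k
    and r :: "real^'d"
  assumes frame: "unit_norm_tight_frame \<Phi> A"
    and sep: "separated (coherence \<Phi>) \<rho> \<beta> x k"
    and mu: "0 \<le> coherence \<Phi>" and r: "norm r \<le> \<rho>" and beta: "\<beta> < 1/2"
begin

lemma noise_bound_nonneg: "0 \<le> \<rho>" using r norm_ge_zero[of r] by linarith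

lemmas sep_facts = sep mu noise_bound_nonneg beta

lemma norm_signal_le: "norm (synth \<Phi> x + r) \<le> sqrt A + \<rho>"
  using norm_triangle_ineq[of "synth \<Phi> x" r] norm_synth_le[OF frame, of x] r sep
  unfolding separated_def by simp

text \<open>The coefficient is at most 1 and the interference at most 1/2. Unlike the norm bound
  sqrt A + \<rho>, this does not grow with A, which keeps the range of the differences studied later
  small.\<close>

lemma abs_inner_dominant_atom_le: "\<bar>\<Phi> k \<bullet> (synth \<Phi> x + r)\<bar> \<le> 3/2"
proof -
  have "0 \<le> coherence \<Phi> * \<bar>x $ k\<bar>" using mu by simp
  then show ?thesis
    using abs_inner_frame_signal[OF frame r, of k x] separated_interference[OF sep_facts]
      separated_max_le_1[OF sep_facts] by linarith
qed

text \<open>Let I be \<mu> times the l1 norm plus \<rho>; it bounds how far the modulus of each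
  frame correlation is from the coefficient's modulus. Separation leaves |x_k| - t - 2 I \<ge> (1 -
  2 \<beta>) (|x_k| - t), and moving two competing atoms by \<epsilon> costs at most twice
  \<epsilon> (sqrt A + \<rho>).\<close>

lemma linf_norm_near_frame:
  assumes near: "\<And>j. norm (\<Psi> j - \<Phi> j) \<le> \<epsilon>"
    and eps: "\<epsilon> * (sqrt A + \<rho>) * (3 * sqrt (real CARD('k))) \<le> 1 - 2 * \<beta>"
  shows "linf_norm (analysis_op \<Psi> (synth \<Phi> x + r)) = \<bar>\<Psi> k \<bullet> (synth \<Phi> x + r)\<bar>"
proof -
  let ?y = "synth \<Phi> x + r" and ?\<mu> = "coherence \<Phi>"
  obtain t where t: "0 \<le> t" "t < \<bar>x $ k\<bar>" "\<And>j. j \<noteq> k \<Longrightarrow> \<bar>x $ j\<bar> \<le> t"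
      "t + ?\<mu> * (\<Sum>j\<in>UNIV. \<bar>x $ j\<bar>) + \<rho> \<le> \<beta> * (\<bar>x $ k\<bar> - t)"
    using sep unfolding separated_def by auto
  have sK: "0 < sqrt (real CARD('k))" by simp
  have pert: "\<bar>\<bar>\<Psi> j \<bullet> ?y\<bar> - \<bar>\<Phi> j \<bullet> ?y\<bar>\<bar> \<le> \<epsilon> * (sqrt A + \<rho>)" for j
  proof -
    have "\<bar>(\<Psi> j - \<Phi> j) \<bullet> ?y\<bar> \<le> norm (\<Psi> j - \<Phi> j) * norm ?y" by (rule Cauchy_Schwarz_ineq2)
    also have "\<dots> \<le> \<epsilon> * (sqrt A + \<rho>)"
      using near[of j] norm_signal_le norm_ge_zero[of "\<Psi> j - \<Phi> j"] by (intro mult_mono) (auto simp del: norm_ge_zero intro: order_trans[OF norm_ge_zero])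
    finally show ?thesis by (simp add: inner_diff_left)
  qed
  \<comment> \<open>With |x_k| \<ge> 1 / sqrt K the gap is at least 2 / (3 sqrt K); this is where
    the factor 3 sqrt K in the bound on \<epsilon> comes from.\<close>
  have "t \<le> \<bar>x $ k\<bar> / 3" by (rule separated_second_le[OF sep_facts t(1,2,4)])
  then have "2/3 * (1 / sqrt (real CARD('k))) \<le> \<bar>x $ k\<bar> - t"
    using separated_max_ge_sqrt[OF sep_facts] by linarith
  then have "(1 - 2 * \<beta>) * (2/3 * (1 / sqrt (real CARD('k)))) \<le> (1 - 2 * \<beta>) * (\<bar>x $ k\<bar> - t)"
    using beta by (intro mult_left_mono) auto
  moreover have "2 * (\<epsilon> * (sqrt A + \<rho>)) \<le> (1 - 2 * \<beta>) * (2/3 * (1 / sqrt (real CARD('k))))"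
    using eps sK by (simp add: field_simps)
  ultimately have e: "2 * (\<epsilon> * (sqrt A + \<rho>)) \<le> (1 - 2 * \<beta>) * (\<bar>x $ k\<bar> - t)" by linarith
  have "\<bar>\<Psi> j \<bullet> ?y\<bar> \<le> \<bar>\<Psi> k \<bullet> ?y\<bar>" for j
  proof (cases "j = k")
    case False
    have tri: "\<bar>\<bar>u\<bar> - \<bar>v\<bar>\<bar> \<le> b" if "\<bar>u - v\<bar> \<le> b" for u v b :: real using that by linarith
    have frame_term: "\<bar>\<bar>\<Phi> l \<bullet> ?y\<bar> - \<bar>x $ l\<bar>\<bar> \<le> ?\<mu> * (\<Sum>j\<in>UNIV. \<bar>x $ j\<bar>) + \<rho>" for l
    proof -
      have "0 \<le> ?\<mu> * \<bar>x $ l\<bar>" using mu by simp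
      then show ?thesis using tri[OF abs_inner_frame_signal[OF frame r, of l x]] by linarith
    qed
    have "\<bar>\<Psi> j \<bullet> ?y\<bar> \<le> \<bar>x $ j\<bar> + (?\<mu> * (\<Sum>j\<in>UNIV. \<bar>x $ j\<bar>) + \<rho>) + \<epsilon> * (sqrt A + \<rho>)"
      using abs_le_D1[OF pert[of j]] abs_le_D1[OF frame_term[of j]] by argo
    also have "\<dots> \<le> \<bar>x $ k\<bar> - (?\<mu> * (\<Sum>j\<in>UNIV. \<bar>x $ j\<bar>) + \<rho>) - \<epsilon> * (sqrt A + \<rho>)"
      using t(3)[OF False] e t(1,4) by (simp add: algebra_simps)
    also have "\<dots> \<le> \<bar>\<Psi> k \<bullet> ?y\<bar>"
      using abs_le_D2[OF pert[of k]] abs_le_D2[OF frame_term[of k]] by argo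
    finally show ?thesis .
  qed simp
  then show ?thesis using linf_norm_eqI[of "analysis_op \<Psi> ?y" k] by (simp add: analysis_op_def)
qed

end

section \<open>Moments on the event that a given coefficient dominates\<close>

lemma open_dominant: "open (dominant (k :: 'k::finite))"
proof -
  have "dominant k = (\<Inter>j\<in>UNIV - {k}. {x. \<bar>x $ j\<bar> < \<bar>x $ k\<bar>})"
    by (auto simp: dominant_def)
  moreover have "open {x :: real^'k. \<bar>x $ j\<bar> < \<bar>x $ k\<bar>}" for j
    by (intro open_Collect_less continuous_intros)
  ultimately show ?thesis by (auto intro!: open_INT)
qed

lemma dominant_measurable [measurable]: "dominant (k :: 'k::finite) \<in> sets borel"
  using open_dominant by (rule borel_open)

lemma borel_measurable_vec_nth [measurable]: "(\<lambda>x. x $ i) \<in> borel_measurable (borel :: (real^'k::finite) measure)"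
  by (intro borel_measurable_continuous_onI continuous_intros)

lemma dominant_unique: "x \<in> dominant k \<Longrightarrow> x \<in> dominant l \<Longrightarrow> k = l"
  unfolding dominant_def by force

lemma sum_indicator_dominant:
  fixes g :: "'k::finite \<Rightarrow> real"
  assumes "x \<in> dominant k"
  shows "(\<Sum>j\<in>UNIV. indicator (dominant j) x * g j) = g k"
proof -
  have "(\<Sum>j\<in>UNIV. indicator (dominant j) x * g j) = (\<Sum>j\<in>UNIV. if j = k then g j else 0)"
  proof (rule sum.cong[OF refl])
    show "indicator (dominant j) x * g j = (if j = k then g j else 0)" for j
      using assms dominant_unique[OF assms, of j] by (cases "x \<in> dominant j") auto
  qed
  then show ?thesis by simp
qed

lemma linf_norm_dominant:
  assumes "x \<in> dominant k" shows "linf_norm x = \<bar>x $ k\<bar>"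
proof (rule linf_norm_eqI)
  show "\<bar>x $ j\<bar> \<le> \<bar>x $ k\<bar>" for j using assms by (cases "j = k") (auto simp: dominant_def less_imp_le)
qed

lemma borel_measurable_linf_norm [measurable]: "(linf_norm :: real^'k::finite \<Rightarrow> real) \<in> borel_measurable borel"
proof -
  have "(\<lambda>x :: real^'k. Max ((\<lambda>i. \<bar>x $ i\<bar>) ` UNIV)) \<in> borel_measurable borel"
    by (rule borel_measurable_Max) (auto intro!: borel_measurable_continuous_onI continuous_intros)
  then show ?thesis unfolding linf_norm_def[abs_def] .
qed

text \<open>The properties of \<nu> behind the moment formulas. The gap condition enters as
  \<open>dom\<close>, and \<open>two\<close> permits division by K - 1.\<close>

locale dominant_symmetric = prob_space \<nu> for \<nu> :: "(real^'k::finite) measure" +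
  assumes sets_eq [measurable_cong]: "sets \<nu> = sets borel"
    and symmetric: "symmetric_measure \<nu>"
    and unit: "AE x in \<nu>. norm x = 1"
    and dom: "AE x in \<nu>. \<exists>k. x \<in> dominant k"
    and two: "CARD('k) \<ge> 2"
begin

lemma space_UNIV [simp]: "space \<nu> = UNIV"
  using sets_eq_imp_space_eq[OF sets_eq] by simp

lemma integral_sign_flip:
  fixes f :: "real^'k \<Rightarrow> real"
  assumes [measurable]: "f \<in> borel_measurable borel" and s: "\<And>i. s i = 1 \<or> s i = (-1::real)"
  shows "integral\<^sup>L \<nu> (\<lambda>x. f (\<chi> i. s i * x $ i)) = integral\<^sup>L \<nu> f"
proof -
  have meas: "(\<lambda>x :: real^'k. \<chi> i. s i * x $ i) \<in> \<nu> \<rightarrow>\<^sub>M borel"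
    by (subst measurable_cong_sets[OF sets_eq refl])
      (auto intro!: borel_measurable_continuous_onI continuous_intros)
  have "distr \<nu> borel (\<lambda>x. \<chi> i. s i * x $ i) = \<nu>"
  proof -
    have "(\<forall>i. (\<chi> i. s i) $ i = 1 \<or> (\<chi> i. s i) $ i = - 1) \<longrightarrow>
        distr \<nu> borel (\<lambda>x. \<chi> i. (\<chi> i. s i) $ i * x $ i) = \<nu>"
      using symmetric unfolding symmetric_measure_def by blast
    then show ?thesis using s by simp
  qed
  then have "integral\<^sup>L \<nu> f = integral\<^sup>L (distr \<nu> borel (\<lambda>x. \<chi> i. s i * x $ i)) f" by simp
  also have "\<dots> = integral\<^sup>L \<nu> (\<lambda>x. f (\<chi> i. s i * x $ i))"
    by (rule integral_distr[OF meas]) simp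
  finally show ?thesis by simp
qed

lemma integral_permute:
  fixes f :: "real^'k \<Rightarrow> real"
  assumes [measurable]: "f \<in> borel_measurable borel" and p: "p permutes UNIV"
  shows "integral\<^sup>L \<nu> (\<lambda>x. f (\<chi> i. x $ p i)) = integral\<^sup>L \<nu> f"
proof -
  have meas: "(\<lambda>x :: real^'k. \<chi> i. x $ p i) \<in> \<nu> \<rightarrow>\<^sub>M borel"
    by (subst measurable_cong_sets[OF sets_eq refl])
      (auto intro!: borel_measurable_continuous_onI continuous_intros)
  have "distr \<nu> borel (\<lambda>x. \<chi> i. x $ p i) = \<nu>"
    using symmetric p unfolding symmetric_measure_def by auto
  then have "integral\<^sup>L \<nu> f = integral\<^sup>L (distr \<nu> borel (\<lambda>x. \<chi> i. x $ p i)) f" by simp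
  also have "\<dots> = integral\<^sup>L \<nu> (\<lambda>x. f (\<chi> i. x $ p i))"
    by (rule integral_distr[OF meas]) simp
  finally show ?thesis by simp
qed

lemma indicator_dominant_sign_flip:
  assumes "\<And>i. s i = 1 \<or> s i = (-1::real)"
  shows "indicator (dominant k) (\<chi> i. s i * x $ i) = (indicator (dominant k) x :: real)"
proof -
  have "\<bar>s i * x $ i\<bar> = \<bar>x $ i\<bar>" for i using assms[of i] by (auto simp: abs_mult)
  then show ?thesis by (auto simp: indicator_def dominant_def)
qed

text \<open>Coordinate k of the permuted vector is coordinate p k of the original one.\<close>

lemma indicator_dominant_permute:
  assumes "p permutes UNIV"
  shows "indicator (dominant k) (\<chi> i. x $ p i) = (indicator (dominant (p k)) x :: real)"
proof -
  have b: "bij p" using permutes_bij[OF assms] .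
  have "x \<in> dominant (p k)" if "(\<chi> i. x $ p i) \<in> dominant k"
    unfolding dominant_def
  proof (intro CollectI allI impI)
    fix j assume j: "j \<noteq> p k"
    obtain i where "j = p i" using bij_is_surj[OF b] by (meson surjE)
    then show "\<bar>x $ j\<bar> < \<bar>x $ p k\<bar>" using j that by (auto simp: dominant_def)
  qed
  moreover have "(\<chi> i. x $ p i) \<in> dominant k" if "x \<in> dominant (p k)"
    using that bij_is_inj[OF b] by (auto simp: dominant_def inj_eq)
  ultimately have "(\<chi> i. x $ p i) \<in> dominant k \<longleftrightarrow> x \<in> dominant (p k)" by blast
  then show ?thesis by (simp add: indicator_def)
qed

lemma integrable_dominant_prod:
  "integrable \<nu> (\<lambda>x. indicator (dominant k) x * (x $ l * x $ m))"
proof (rule integrable_const_bound[where B = 1])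
  show "AE x in \<nu>. norm (indicator (dominant k) x * (x $ l * x $ m)) \<le> 1"
    using unit
  proof eventually_elim
    case (elim x)
    have "\<bar>x $ l\<bar> * \<bar>x $ m\<bar> \<le> 1 * 1"
      using component_le_norm_cart[of x] elim by (intro mult_mono) auto
    then show ?case by (auto simp: indicator_def abs_mult)
  qed
qed measurable

text \<open>Flipping the sign of coordinate l negates the product but preserves both \<nu> and the
  event of dominance, so the integral equals its own negative.\<close>

lemma dominant_cross_moment:
  assumes "l \<noteq> m"
  shows "integral\<^sup>L \<nu> (\<lambda>x. indicator (dominant k) x * (x $ l * x $ m)) = 0"
proof -
  define s :: "'k \<Rightarrow> real" where "s = (\<lambda>i. if i = l then -1 else 1)"
  have s: "s i = 1 \<or> s i = -1" for i by (simp add: s_def)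
  let ?f = "\<lambda>x :: real^'k. indicator (dominant k) x * (x $ l * x $ m)"
  have meas: "?f \<in> borel_measurable borel"
    using integrable_dominant_prod[of k l m] borel_measurable_integrable
    by (subst measurable_cong_sets[OF sets_eq[symmetric] refl]) blast
  have "integral\<^sup>L \<nu> ?f = integral\<^sup>L \<nu> (\<lambda>x. ?f (\<chi> i. s i * x $ i))"
    by (rule integral_sign_flip[OF meas, symmetric]) (rule s)
  also have "\<dots> = integral\<^sup>L \<nu> (\<lambda>x. - ?f x)"
    using assms by (simp only: indicator_dominant_sign_flip[OF s]) (simp add: s_def)
  finally show ?thesis by simp
qed

text \<open>Transpositions show that the K events have equal probability, and almost surely exactly
  one of them occurs.\<close>

lemma prob_dominant: "integral\<^sup>L \<nu> (\<lambda>x. indicator (dominant k) x) = (1 / real CARD('k) :: real)"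
proof -
  let ?I = "\<lambda>k. integral\<^sup>L \<nu> (\<lambda>x. indicator (dominant k) x :: real)"
  have eq: "?I j = ?I k" for j
  proof -
    have p: "Transposition.transpose k j permutes (UNIV :: 'k set)" by (simp add: permutes_swap_id)
    show ?thesis
      using integral_permute[OF _ p, of "indicator (dominant k)"] indicator_dominant_permute[OF p, of k]
      by simp
  qed
  have int: "integrable \<nu> (\<lambda>x. indicator (dominant j) x :: real)" for j
    by (rule integrable_const_bound[where B = 1]) auto
  have "1 = integral\<^sup>L \<nu> (\<lambda>x. 1 :: real)" by (simp add: prob_space[simplified])
  also have "\<dots> = integral\<^sup>L \<nu> (\<lambda>x. \<Sum>j\<in>UNIV. indicator (dominant j) x :: real)"
  proof (rule integral_cong_AE)
    show "AE x in \<nu>. 1 = (\<Sum>j\<in>UNIV. indicator (dominant j) x :: real)"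
      using dom
    proof eventually_elim
      case (elim x)
      then show ?case using sum_indicator_dominant[of x _ "\<lambda>_. 1"] by auto
    qed
  qed measurable
  also have "\<dots> = (\<Sum>j\<in>UNIV. ?I j)" using int by (rule Bochner_Integration.integral_sum)
  also have "\<dots> = (\<Sum>j\<in>(UNIV :: 'k set). ?I k)" by (rule sum.cong[OF refl eq])
  also have "\<dots> = real CARD('k) * ?I k" by (rule sum_constant)
  finally show ?thesis by (simp add: field_simps)
qed

text \<open>Almost surely the squared maximum norm is the sum over k of the integrands on the left,
  and transpositions give all of these the same integral.\<close>

lemma dominant_self_moment:
  "integral\<^sup>L \<nu> (\<lambda>x. indicator (dominant k) x * (x $ k * x $ k)) =
    integral\<^sup>L \<nu> (\<lambda>x. (linf_norm x)\<^sup>2) / real CARD('k)"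
proof -
  let ?f = "\<lambda>k (x :: real^'k). indicator (dominant k) x * (x $ k * x $ k)"
  let ?I = "\<lambda>k. integral\<^sup>L \<nu> (?f k)"
  have eq: "?I j = ?I k" for j
  proof -
    have p: "Transposition.transpose k j permutes (UNIV :: 'k set)" by (simp add: permutes_swap_id)
    have meas: "?f k \<in> borel_measurable borel"
      using integrable_dominant_prod[of k k k] borel_measurable_integrable
      by (subst measurable_cong_sets[OF sets_eq[symmetric] refl]) blast
    show ?thesis
      using integral_permute[OF meas p] unfolding indicator_dominant_permute[OF p] vec_lambda_beta by simp
  qed
  have "integral\<^sup>L \<nu> (\<lambda>x. (linf_norm x)\<^sup>2) = integral\<^sup>L \<nu> (\<lambda>x. \<Sum>j\<in>UNIV. ?f j x)"
  proof (rule integral_cong_AE)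
    show "(\<lambda>x. \<Sum>j\<in>UNIV. ?f j x) \<in> borel_measurable \<nu>"
      using integrable_dominant_prod by (intro borel_measurable_sum) blast
    show "AE x in \<nu>. (linf_norm x)\<^sup>2 = (\<Sum>j\<in>UNIV. ?f j x)"
      using dom
    proof eventually_elim
      case (elim x)
      then obtain k where k: "x \<in> dominant k" by blast
      show ?case
        unfolding sum_indicator_dominant[OF k] linf_norm_dominant[OF k] by (simp add: power2_eq_square)
    qed
  qed measurable
  also have "\<dots> = (\<Sum>j\<in>UNIV. ?I j)"
    by (rule Bochner_Integration.integral_sum) (rule integrable_dominant_prod)
  also have "\<dots> = (\<Sum>j\<in>(UNIV :: 'k set). ?I k)" by (rule sum.cong[OF refl eq])
  also have "\<dots> = real CARD('k) * ?I k" by (rule sum_constant)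
  finally show ?thesis by simp
qed

text \<open>Multiply the identity of unit norm by the indicator and integrate: 1 / K splits into the
  moment of k itself and K - 1 equal moments of the other coordinates.\<close>

lemma dominant_other_moment:
  assumes "l \<noteq> k"
  shows "integral\<^sup>L \<nu> (\<lambda>x. indicator (dominant k) x * (x $ l * x $ l)) =
    (1 - integral\<^sup>L \<nu> (\<lambda>x. (linf_norm x)\<^sup>2)) / (real CARD('k) - 1) / real CARD('k)"
proof -
  let ?f = "\<lambda>l (x :: real^'k). indicator (dominant k) x * (x $ l * x $ l)"
  let ?I = "\<lambda>l. integral\<^sup>L \<nu> (?f l)" and ?c = "integral\<^sup>L \<nu> (\<lambda>x. (linf_norm x)\<^sup>2)"
  have eq: "?I j = ?I l" if "j \<noteq> k" for j
  proof -
    have p: "Transposition.transpose l j permutes (UNIV :: 'k set)" by (simp add: permutes_swap_id)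
    have meas: "?f l \<in> borel_measurable borel"
      using integrable_dominant_prod[of k l l] borel_measurable_integrable
      by (subst measurable_cong_sets[OF sets_eq[symmetric] refl]) blast
    \<comment> \<open>Because the transposition fixes k, it leaves the event that k dominates
      unchanged.\<close>
    have "Transposition.transpose l j k = k" using that assms by simp
    then show ?thesis
      using integral_permute[OF meas p] unfolding indicator_dominant_permute[OF p] vec_lambda_beta by simp
  qed
  have "1 / real CARD('k) = integral\<^sup>L \<nu> (\<lambda>x. indicator (dominant k) x)" by (rule prob_dominant[symmetric])
  also have "\<dots> = integral\<^sup>L \<nu> (\<lambda>x. \<Sum>j\<in>UNIV. ?f j x)"
  proof (rule integral_cong_AE)
    show "(\<lambda>x. \<Sum>j\<in>UNIV. ?f j x) \<in> borel_measurable \<nu>"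
      using integrable_dominant_prod by (intro borel_measurable_sum) blast
    show "AE x in \<nu>. indicator (dominant k) x = (\<Sum>j\<in>UNIV. ?f j x)"
      using unit
    proof eventually_elim
      case (elim x)
      then show ?case using norm_square_vec[of x]
        by (simp add: sum_distrib_left[symmetric] power2_eq_square)
    qed
  qed measurable
  also have "\<dots> = (\<Sum>j\<in>UNIV. ?I j)"
    by (rule Bochner_Integration.integral_sum) (rule integrable_dominant_prod)
  also have "\<dots> = ?I k + (\<Sum>j\<in>UNIV - {k}. ?I j)" by (rule sum.remove) auto
  also have "(\<Sum>j\<in>UNIV - {k}. ?I j) = (\<Sum>j\<in>UNIV - {k}. ?I l)" by (rule sum.cong) (auto simp: eq)
  also have "\<dots> = (real CARD('k) - 1) * ?I l"
    by (simp add: card_Diff_singleton of_nat_diff Suc_leI)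
  also have "?I k = ?c / real CARD('k)" by (rule dominant_self_moment)
  finally show ?thesis using two by (simp add: field_simps)
qed

text \<open>After expanding the square only diagonal moments survive, with weight c at k and b
  elsewhere. Putting weight b on every atom lets the frame identity sum them, and the excess c - b,
  which is \<lambda>, remains at atom k.\<close>

lemma dominant_quadratic_moment:
  fixes \<Phi> :: "'k \<Rightarrow> real^'d::finite" and u :: "real^'d"
  assumes frame: "unit_norm_tight_frame \<Phi> A"
  defines "c \<equiv> integral\<^sup>L \<nu> (\<lambda>x. (linf_norm x)\<^sup>2)"
  defines "b \<equiv> (1 - c) / (real CARD('k) - 1)"
  shows "integral\<^sup>L \<nu> (\<lambda>x. indicator (dominant k) x * (u \<bullet> synth \<Phi> x)\<^sup>2) =
    ((c - b) * (\<Phi> k \<bullet> u)\<^sup>2 + b * A * (norm u)\<^sup>2) / real CARD('k)"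
proof -
  let ?f = "\<lambda>l m (x :: real^'k). indicator (dominant k) x * (x $ l * x $ m)"
  let ?I = "\<lambda>l m. integral\<^sup>L \<nu> (?f l m)"
  let ?w = "\<lambda>l. u \<bullet> \<Phi> l"
  have diag: "?I l l = (if l = k then c else b) / real CARD('k)" for l
    using dominant_self_moment[of k] dominant_other_moment[of l k] by (simp add: b_def c_def)
  have "integral\<^sup>L \<nu> (\<lambda>x. indicator (dominant k) x * (u \<bullet> synth \<Phi> x)\<^sup>2) =
      integral\<^sup>L \<nu> (\<lambda>x. \<Sum>l\<in>UNIV. \<Sum>m\<in>UNIV. ?w l * ?w m * ?f l m x)"
    by (intro Bochner_Integration.integral_cong refl)
      (simp add: inner_synth power2_eq_square sum_product sum_distrib_left mult_ac)
  also have "\<dots> = (\<Sum>l\<in>UNIV. \<Sum>m\<in>UNIV. ?w l * ?w m * ?I l m)"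
    using integrable_dominant_prod by (simp add: Bochner_Integration.integral_sum)
  also have "\<dots> = (\<Sum>l\<in>UNIV. ?w l * ?w l * ?I l l)"
  proof (rule sum.cong[OF refl])
    fix l
    have "(\<Sum>m\<in>UNIV. ?w l * ?w m * ?I l m) = (\<Sum>m\<in>UNIV. if m = l then ?w l * ?w l * ?I l l else 0)"
      by (rule sum.cong) (auto simp: dominant_cross_moment)
    then show "(\<Sum>m\<in>UNIV. ?w l * ?w m * ?I l m) = ?w l * ?w l * ?I l l" by simp
  qed
  also have "\<dots> = (\<Sum>l\<in>UNIV. (b * (\<Phi> l \<bullet> u)\<^sup>2 + (if l = k then (c - b) * (\<Phi> l \<bullet> u)\<^sup>2 else 0)) / real CARD('k))"
    unfolding diag
    by (rule sum.cong) (auto simp: power2_eq_square inner_commute[of u] algebra_simps diff_divide_distrib add_divide_distrib)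
  also have "\<dots> = (b * (\<Sum>l\<in>UNIV. (\<Phi> l \<bullet> u)\<^sup>2) + (c - b) * (\<Phi> k \<bullet> u)\<^sup>2) / real CARD('k)"
    by (simp add: sum_divide_distrib[symmetric] sum.distrib sum_distrib_left)
  finally show ?thesis using unit_norm_tight_frameD(2)[OF frame, of u] by (simp add: algebra_simps)
qed

end

section \<open>Second moments of noisy signals\<close>

lemma synth_measurable [measurable]:
  "synth (\<Phi> :: 'k::finite \<Rightarrow> real^'d::finite) \<in> borel_measurable borel"
  unfolding synth_def[abs_def] by (intro borel_measurable_continuous_onI continuous_intros)

context prob_space
begin

context
  fixes X :: "'a \<Rightarrow> real^'k::finite" and R :: "'a \<Rightarrow> real^'d::finite" and \<nu> :: "(real^'k) measure"
    and \<Phi> :: "'k \<Rightarrow> real^'d" and A \<rho> \<rho>max :: real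
  assumes X [measurable]: "X \<in> borel_measurable M" and R [measurable]: "R \<in> borel_measurable M"
    and dist_X: "distr M borel X = \<nu>" and nu: "dominant_symmetric \<nu>"
    and indep_XR: "indep_set (sets (vimage_algebra (space M) X borel)) (sets (vimage_algebra (space M) R borel))"
    and R_bounded: "AE \<omega> in M. norm (R \<omega>) \<le> \<rho>max"
    and R_mean: "integral\<^sup>L M R = 0"
    and R_cov: "\<And>i j. integral\<^sup>L M (\<lambda>\<omega>. R \<omega> $ i * R \<omega> $ j) = (if i = j then \<rho>\<^sup>2 else 0)"
    and frame: "unit_norm_tight_frame \<Phi> A"
begin

interpretation nu: dominant_symmetric \<nu> by (rule nu)

lemma expectation_of_X:
  fixes f :: "real^'k \<Rightarrow> real"
  assumes "f \<in> borel_measurable borel"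
  shows "expectation (\<lambda>\<omega>. f (X \<omega>)) = integral\<^sup>L \<nu> f"
  using integral_distr[OF X, of f] assms unfolding dist_X by simp

lemma expectation_indicator_dominant: "expectation (\<lambda>\<omega>. indicator (dominant k) (X \<omega>)) = 1 / real CARD('k)"
  using expectation_of_X[of "indicator (dominant k)"] nu.prob_dominant[of k] by simp

lemma unit_X: "AE \<omega> in M. norm (X \<omega>) = 1"
  using nu.unit unfolding dist_X[symmetric] by (rule AE_distrD[OF X])

lemma bounded_inner_R: "AE \<omega> in M. \<bar>u \<bullet> R \<omega>\<bar> \<le> norm u * \<rho>max"
  using R_bounded
proof eventually_elim
  case (elim \<omega>)
  then show ?case using Cauchy_Schwarz_ineq2[of u "R \<omega>"] mult_left_mono[OF elim, of "norm u"] by simp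
qed

lemma bounded_inner_synth: "AE \<omega> in M. \<bar>u \<bullet> synth \<Phi> (X \<omega>)\<bar> \<le> norm u * sqrt A"
  using unit_X
proof eventually_elim
  case (elim \<omega>)
  then show ?case using Cauchy_Schwarz_ineq2[of u "synth \<Phi> (X \<omega>)"]
      mult_left_mono[OF norm_synth_le[OF frame, of "X \<omega>"], of "norm u"] by simp
qed

text \<open>Independence is given for the sigma-algebras generated by X and R. Those generated by
  \<open>f\<close> of X and \<open>g\<close> of R are contained in them, so the product rule for
  independent real variables applies.\<close>

lemma indep_expectation:
  fixes f :: "real^'k \<Rightarrow> real" and g :: "real^'d \<Rightarrow> real"
  assumes [measurable]: "f \<in> borel_measurable borel" "g \<in> borel_measurable borel"
    and int: "integrable M (\<lambda>\<omega>. f (X \<omega>))" "integrable M (\<lambda>\<omega>. g (R \<omega>))"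
  shows "expectation (\<lambda>\<omega>. f (X \<omega>) * g (R \<omega>)) = expectation (\<lambda>\<omega>. f (X \<omega>)) * expectation (\<lambda>\<omega>. g (R \<omega>))"
    and "integrable M (\<lambda>\<omega>. f (X \<omega>) * g (R \<omega>))"
proof -
  have sub: "sigma_sets (space M) {(\<lambda>\<omega>. h (Z \<omega>)) -` B \<inter> space M | B. B \<in> sets borel}
      \<subseteq> sets (vimage_algebra (space M) Z borel)"
    if "h \<in> borel_measurable borel" for h :: "real^'n::finite \<Rightarrow> real" and Z :: "'a \<Rightarrow> real^'n"
  proof -
    have "(\<lambda>\<omega>. h (Z \<omega>)) \<in> borel_measurable (vimage_algebra (space M) Z borel)"
      by (rule measurable_compose[OF measurable_vimage_algebra1 that]) simp
    from measurable_sets[OF this]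
    have "{(\<lambda>\<omega>. h (Z \<omega>)) -` B \<inter> space M | B. B \<in> sets borel} \<subseteq> sets (vimage_algebra (space M) Z borel)"
      by auto
    from sets.sigma_sets_subset[OF this] show ?thesis by simp
  qed
  have "indep_var borel (\<lambda>\<omega>. f (X \<omega>)) borel (\<lambda>\<omega>. g (R \<omega>))"
    unfolding indep_var_eq
  proof (intro conjI)
    show "indep_set (sigma_sets (space M) {(\<lambda>\<omega>. f (X \<omega>)) -` B \<inter> space M | B. B \<in> sets borel})
        (sigma_sets (space M) {(\<lambda>\<omega>. g (R \<omega>)) -` B \<inter> space M | B. B \<in> sets borel})"
      using indep_XR sub[OF assms(1), of X] sub[OF assms(2), of R] unfolding indep_sets2_eq by blast
  qed measurable
  from indep_var_lebesgue_integral[OF this int] indep_var_integrable[OF this int]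
  show "expectation (\<lambda>\<omega>. f (X \<omega>) * g (R \<omega>)) = expectation (\<lambda>\<omega>. f (X \<omega>)) * expectation (\<lambda>\<omega>. g (R \<omega>))"
    and "integrable M (\<lambda>\<omega>. f (X \<omega>) * g (R \<omega>))" .
qed

text \<open>The square splits into signal, cross and noise terms. The cross term vanishes by
  independence and zero mean; by independence the noise term is the probability 1 / K of dominance
  times \<open>\<rho>\<^sup>2 * (norm u)\<^sup>2\<close>. Thus beyond the \<lambda> term everything
  depends on u through its norm only.\<close>

lemma signal_quadratic_moment:
  fixes u :: "real^'d"
  defines "c \<equiv> integral\<^sup>L \<nu> (\<lambda>x. (linf_norm x)\<^sup>2)"
  defines "b \<equiv> (1 - c) / (real CARD('k) - 1)"
  shows "integrable M (\<lambda>\<omega>. indicator (dominant k) (X \<omega>) * (u \<bullet> (synth \<Phi> (X \<omega>) + R \<omega>))\<^sup>2)" (is "integrable M ?h")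
    and "expectation (\<lambda>\<omega>. indicator (dominant k) (X \<omega>) * (u \<bullet> (synth \<Phi> (X \<omega>) + R \<omega>))\<^sup>2) =
      ((c - b) * (\<Phi> k \<bullet> u)\<^sup>2 + (b * A + \<rho>\<^sup>2) * (norm u)\<^sup>2) / real CARD('k)"
proof -
  let ?i = "\<lambda>x. indicator (dominant k) x :: real"
  have int1: "integrable M (\<lambda>\<omega>. ?i (X \<omega>) * (u \<bullet> synth \<Phi> (X \<omega>)))"
  proof (rule integrable_const_bound[where B = "norm u * sqrt A"])
    show "AE \<omega> in M. norm (?i (X \<omega>) * (u \<bullet> synth \<Phi> (X \<omega>))) \<le> norm u * sqrt A"
      using bounded_inner_synth[of u] by eventually_elim (auto simp: indicator_def)
  qed measurable
  have int2: "integrable M (\<lambda>\<omega>. ?i (X \<omega>) * (u \<bullet> synth \<Phi> (X \<omega>))\<^sup>2)"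
  proof (rule integrable_const_bound[where B = "(norm u * sqrt A)\<^sup>2"])
    show "AE \<omega> in M. norm (?i (X \<omega>) * (u \<bullet> synth \<Phi> (X \<omega>))\<^sup>2) \<le> (norm u * sqrt A)\<^sup>2"
      using bounded_inner_synth[of u]
    proof eventually_elim
      case (elim \<omega>)
      have "(u \<bullet> synth \<Phi> (X \<omega>))\<^sup>2 \<le> (norm u * sqrt A)\<^sup>2"
        using elim by (metis abs_le_square_iff abs_of_nonneg abs_ge_zero order_trans)
      then show ?case by (auto simp: indicator_def)
    qed
  qed measurable
  have int3: "integrable M (\<lambda>\<omega>. u \<bullet> R \<omega>)"
    by (rule integrable_const_bound[where B = "norm u * \<rho>max"]) (use bounded_inner_R[of u] in auto)
  have int4: "integrable M (\<lambda>\<omega>. (u \<bullet> R \<omega>)\<^sup>2)"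
  proof (rule integrable_const_bound[where B = "(norm u * \<rho>max)\<^sup>2"])
    show "AE \<omega> in M. norm ((u \<bullet> R \<omega>)\<^sup>2) \<le> (norm u * \<rho>max)\<^sup>2"
      using bounded_inner_R[of u]
    proof eventually_elim
      case (elim \<omega>)
      have "(u \<bullet> R \<omega>)\<^sup>2 \<le> (norm u * \<rho>max)\<^sup>2"
        using elim by (metis abs_le_square_iff abs_of_nonneg abs_ge_zero order_trans)
      then show ?case by simp
    qed
  qed measurable
  have int5: "integrable M (\<lambda>\<omega>. ?i (X \<omega>))"
    by (rule integrable_const_bound[where B = 1]) auto
  have intRR: "integrable M (\<lambda>\<omega>. R \<omega> $ i * R \<omega> $ j)" for i j
  proof (rule integrable_const_bound[where B = "\<rho>max * \<rho>max"])
    show "AE \<omega> in M. norm (R \<omega> $ i * R \<omega> $ j) \<le> \<rho>max * \<rho>max"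
      using R_bounded
    proof eventually_elim
      case (elim \<omega>)
      have "\<bar>R \<omega> $ i\<bar> * \<bar>R \<omega> $ j\<bar> \<le> \<rho>max * \<rho>max"
        using component_le_norm_cart[of "R \<omega>"] elim order_trans[OF norm_ge_zero elim]
        by (intro mult_mono) (auto intro: order_trans)
      then show ?case by (simp add: abs_mult)
    qed
  qed measurable
  have intR: "integrable M R"
    using R_bounded by (intro integrable_const_bound[where B = \<rho>max]) auto
  have mean0: "expectation (\<lambda>\<omega>. u \<bullet> R \<omega>) = 0"
    using R_mean intR by simp
  have cov: "expectation (\<lambda>\<omega>. (u \<bullet> R \<omega>)\<^sup>2) = \<rho>\<^sup>2 * (norm u)\<^sup>2"
  proof -
    have "expectation (\<lambda>\<omega>. (u \<bullet> R \<omega>)\<^sup>2) =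
        expectation (\<lambda>\<omega>. \<Sum>i\<in>UNIV. \<Sum>j\<in>UNIV. u $ i * u $ j * (R \<omega> $ i * R \<omega> $ j))"
      by (simp add: inner_vec_def power2_eq_square sum_product mult_ac)
    also have "\<dots> = (\<Sum>i\<in>UNIV. \<Sum>j\<in>UNIV. u $ i * u $ j * (if i = j then \<rho>\<^sup>2 else 0))"
      using intRR by (simp add: Bochner_Integration.integral_sum R_cov)
    also have "\<dots> = (\<Sum>i\<in>UNIV. u $ i * u $ i * \<rho>\<^sup>2)"
      by (intro sum.cong refl) (simp add: sum.delta' if_distrib[of "\<lambda>c. _ * c"] cong: if_cong)
    also have "\<dots> = \<rho>\<^sup>2 * (norm u)\<^sup>2"
      unfolding norm_square_vec by (simp add: sum_distrib_left power2_eq_square mult_ac)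
    finally show ?thesis .
  qed
  have split: "?h \<omega> = ?i (X \<omega>) * (u \<bullet> synth \<Phi> (X \<omega>))\<^sup>2 +
      (2 * (?i (X \<omega>) * (u \<bullet> synth \<Phi> (X \<omega>)) * (u \<bullet> R \<omega>)) + ?i (X \<omega>) * (u \<bullet> R \<omega>)\<^sup>2)" for \<omega>
    by (simp add: inner_add_right power2_eq_square algebra_simps)
  have cross: "expectation (\<lambda>\<omega>. ?i (X \<omega>) * (u \<bullet> synth \<Phi> (X \<omega>)) * (u \<bullet> R \<omega>)) = 0"
      "integrable M (\<lambda>\<omega>. ?i (X \<omega>) * (u \<bullet> synth \<Phi> (X \<omega>)) * (u \<bullet> R \<omega>))"
    using indep_expectation[OF _ _ int1 int3] mean0 by simp_all
  have noise: "expectation (\<lambda>\<omega>. ?i (X \<omega>) * (u \<bullet> R \<omega>)\<^sup>2) = 1 / real CARD('k) * (\<rho>\<^sup>2 * (norm u)\<^sup>2)"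
      "integrable M (\<lambda>\<omega>. ?i (X \<omega>) * (u \<bullet> R \<omega>)\<^sup>2)"
    using indep_expectation[OF _ _ int5 int4] unfolding cov expectation_indicator_dominant by simp_all
  have signal: "expectation (\<lambda>\<omega>. ?i (X \<omega>) * (u \<bullet> synth \<Phi> (X \<omega>))\<^sup>2) =
      ((c - b) * (\<Phi> k \<bullet> u)\<^sup>2 + b * A * (norm u)\<^sup>2) / real CARD('k)"
    using expectation_of_X[of "\<lambda>x. ?i x * (u \<bullet> synth \<Phi> x)\<^sup>2"] nu.dominant_quadratic_moment[OF frame, of k u]
    by (simp add: b_def c_def)
  show "integrable M ?h" unfolding split using int2 cross(2) noise(2) by simp
  have "expectation ?h = ((c - b) * (\<Phi> k \<bullet> u)\<^sup>2 + b * A * (norm u)\<^sup>2) / real CARD('k) +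
      1 / real CARD('k) * (\<rho>\<^sup>2 * (norm u)\<^sup>2)"
    unfolding split using int2 cross noise by (simp add: signal)
  then show "expectation ?h = ((c - b) * (\<Phi> k \<bullet> u)\<^sup>2 + (b * A + \<rho>\<^sup>2) * (norm u)\<^sup>2) / real CARD('k)"
    by (simp add: field_simps)
qed

end

end

section \<open>Squared correlations on spherical caps\<close>

text \<open>For unit vectors, distance r means inner product
  \<open>1 - r\<^sup>2 / 2\<close>.\<close>

lemma one_minus_inner_square_on_cap_boundary:
  fixes w \<phi> :: "'a::real_inner"
  assumes "norm w = 1" "norm \<phi> = 1" "norm (w - \<phi>) = r"
  shows "1 - (\<phi> \<bullet> w)\<^sup>2 = r\<^sup>2 - r ^ 4 / 4"
proof -
  have "r\<^sup>2 = 2 - 2 * (\<phi> \<bullet> w)"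
    using assms power2_norm_eq_inner[of "w - \<phi>"] power2_norm_eq_inner[of w] power2_norm_eq_inner[of \<phi>]
    by (simp add: inner_diff_left inner_diff_right inner_commute)
  then have eq: "\<phi> \<bullet> w = 1 - r\<^sup>2 / 2" by linarith
  show ?thesis unfolding eq by (simp add: power2_eq_square power4_eq_xxxx algebra_simps)
qed

text \<open>Factor the difference of squares; the factors are at most \<eta> B and 2 B in
  modulus.\<close>

lemma abs_diff_inner_squares_le:
  fixes p w y :: "'a::real_inner"
  assumes "norm (p - w) \<le> \<eta>" "norm y \<le> B" "norm p = 1" "norm w = 1"
  shows "\<bar>(p \<bullet> y)\<^sup>2 - (w \<bullet> y)\<^sup>2\<bar> \<le> 2 * B\<^sup>2 * \<eta>"
proof -
  have B: "0 \<le> B" using assms(2) norm_ge_zero order_trans by blast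
  have \<eta>: "0 \<le> \<eta>" using assms(1) norm_ge_zero order_trans by blast
  have "\<bar>(p - w) \<bullet> y\<bar> \<le> norm (p - w) * norm y" by (rule Cauchy_Schwarz_ineq2)
  also have "\<dots> \<le> \<eta> * B" using assms \<eta> by (intro mult_mono) auto
  finally have 1: "\<bar>(p - w) \<bullet> y\<bar> \<le> \<eta> * B" .
  have "\<bar>(p + w) \<bullet> y\<bar> \<le> norm (p + w) * norm y" by (rule Cauchy_Schwarz_ineq2)
  also have "\<dots> \<le> 2 * B" using assms norm_triangle_ineq[of p w] by (intro mult_mono) auto
  finally have 2: "\<bar>(p + w) \<bullet> y\<bar> \<le> 2 * B" .
  have "(p \<bullet> y)\<^sup>2 - (w \<bullet> y)\<^sup>2 = ((p - w) \<bullet> y) * ((p + w) \<bullet> y)"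
    by (simp add: inner_diff_left inner_add_left power2_eq_square algebra_simps)
  then have "\<bar>(p \<bullet> y)\<^sup>2 - (w \<bullet> y)\<^sup>2\<bar> \<le> (\<eta> * B) * (2 * B)"
    using mult_mono[OF 1 2] B \<eta> by (simp add: abs_mult)
  then show ?thesis by (simp add: power2_eq_square mult_ac)
qed

section \<open>Concentration, nets and local maxima\<close>

text \<open>For u = -v < 0 the identity \<open>(1 - v + v\<^sup>2) * (1 + v) = 1 + v ^ 3\<close>
  together with 1 + v \<le> exp v shows that the quadratic times exp v is at least 1.\<close>

lemma exp_le_quadratic:
  fixes u :: real
  assumes "\<bar>u\<bar> \<le> 1" shows "exp u \<le> 1 + u + u\<^sup>2"
proof (cases "u \<ge> 0")
  case True
  then show ?thesis using exp_bound[of u] assms by simp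
next
  case False
  define v where "v = - u"
  have v: "0 < v" "v \<le> 1" using False assms by (auto simp: v_def)
  have "1 + v \<le> exp v" by (rule exp_ge_add_one_self)
  moreover have "0 < 1 - v + v\<^sup>2" using v by (cases "v = 1") (auto intro: add_pos_nonneg)
  ultimately have "(1 - v + v\<^sup>2) * (1 + v) \<le> (1 - v + v\<^sup>2) * exp v"
    by (intro mult_left_mono) auto
  moreover have "(1 - v + v\<^sup>2) * (1 + v) = 1 + v ^ 3"
    by (simp add: algebra_simps power2_eq_square power3_eq_cube)
  moreover have "0 \<le> v ^ 3" using v by simp
  ultimately have "1 \<le> (1 - v + v\<^sup>2) * exp v" by linarith
  then have "exp (- v) \<le> 1 - v + v\<^sup>2"
    by (simp add: exp_minus field_simps)
  then show ?thesis by (simp add: v_def)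
qed

text \<open>Integrate the quadratic bound on exp, valid since \<theta> |Z| \<le> 1, and then use 1 +
  s \<le> exp s. Here \<open>v\<close> bounds the second moment, not the centred variance.\<close>

lemma (in prob_space) mgf_le_of_bounded:
  fixes Z :: "'a \<Rightarrow> real"
  assumes [measurable]: "Z \<in> borel_measurable M"
    and bnd: "AE \<omega> in M. \<bar>Z \<omega>\<bar> \<le> L" and v: "expectation (\<lambda>\<omega>. (Z \<omega>)\<^sup>2) \<le> v"
    and \<theta>: "0 \<le> \<theta>" "\<theta> * L \<le> 1"
  shows "integrable M (\<lambda>\<omega>. exp (- (\<theta> * Z \<omega>)))"
    and "expectation (\<lambda>\<omega>. exp (- (\<theta> * Z \<omega>))) \<le> exp (- \<theta> * expectation Z + \<theta>\<^sup>2 * v)"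
proof -
  have small: "\<bar>\<theta> * Z \<omega>\<bar> \<le> 1" if "\<bar>Z \<omega>\<bar> \<le> L" for \<omega>
    using mult_left_mono[OF that \<theta>(1)] \<theta> by (simp add: abs_mult)
  show int: "integrable M (\<lambda>\<omega>. exp (- (\<theta> * Z \<omega>)))"
  proof (rule integrable_const_bound[where B = "exp 1"])
    show "AE \<omega> in M. norm (exp (- (\<theta> * Z \<omega>))) \<le> exp 1"
      using bnd
    proof eventually_elim
      case (elim \<omega>)
      show ?case using small[OF elim] by simp
    qed
  qed simp
  have intZ: "integrable M Z"
    using bnd by (intro integrable_const_bound[where B = L]) auto
  have intZ2: "integrable M (\<lambda>\<omega>. (Z \<omega>)\<^sup>2)"
    using bnd by (intro integrable_const_bound[where B = "L\<^sup>2"]) (auto elim!: eventually_mono intro: abs_le_square_iff[THEN iffD1] order_trans[OF _ abs_ge_self])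
  have "expectation (\<lambda>\<omega>. exp (- (\<theta> * Z \<omega>))) \<le> expectation (\<lambda>\<omega>. 1 - \<theta> * Z \<omega> + \<theta>\<^sup>2 * (Z \<omega>)\<^sup>2)"
  proof (rule integral_mono_AE[OF int])
    show "integrable M (\<lambda>\<omega>. 1 - \<theta> * Z \<omega> + \<theta>\<^sup>2 * (Z \<omega>)\<^sup>2)"
      using intZ intZ2 by auto
    show "AE \<omega> in M. exp (- (\<theta> * Z \<omega>)) \<le> 1 - \<theta> * Z \<omega> + \<theta>\<^sup>2 * (Z \<omega>)\<^sup>2"
      using bnd
    proof eventually_elim
      case (elim \<omega>)
      show ?case using exp_le_quadratic[of "- (\<theta> * Z \<omega>)"] small[OF elim]
        by (simp add: power_mult_distrib)
    qed
  qed
  also have "\<dots> = 1 - \<theta> * expectation Z + \<theta>\<^sup>2 * expectation (\<lambda>\<omega>. (Z \<omega>)\<^sup>2)"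
    using intZ intZ2 by (simp add: prob_space)
  also have "\<dots> \<le> 1 + (- \<theta> * expectation Z + \<theta>\<^sup>2 * v)"
    using v by (simp add: mult_left_mono)
  also have "\<dots> \<le> exp (- \<theta> * expectation Z + \<theta>\<^sup>2 * v)" by (rule exp_ge_add_one_self)
  finally show "expectation (\<lambda>\<omega>. exp (- (\<theta> * Z \<omega>))) \<le> exp (- \<theta> * expectation Z + \<theta>\<^sup>2 * v)" .
qed

text \<open>Chernoff's method: Markov's inequality for the product of the independent factors exp
  (-\<theta> Z_n).\<close>

lemma (in prob_space) bernstein_half_mean:
  fixes Z :: "nat \<Rightarrow> 'a \<Rightarrow> real"
  assumes ind: "indep_vars (\<lambda>_. borel) Z {..<N}"
    and bnd: "\<And>n. n < N \<Longrightarrow> AE \<omega> in M. \<bar>Z n \<omega>\<bar> \<le> L"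
    and mean: "\<And>n. n < N \<Longrightarrow> expectation (Z n) = m"
    and var: "\<And>n. n < N \<Longrightarrow> expectation (\<lambda>\<omega>. (Z n \<omega>)\<^sup>2) \<le> v"
    and m: "0 \<le> m" and v: "0 < v" and mL: "m * L \<le> 4 * v"
  shows "prob {\<omega> \<in> space M. (\<Sum>n<N. Z n \<omega>) \<le> real N * m / 2} \<le> exp (- (real N * m\<^sup>2 / (16 * v)))"
proof -
  \<comment> \<open>Minimises \<open>\<theta>\<^sup>2 * v - \<theta> * m / 2\<close>, the exponent
    per sample, with value \<open>- m\<^sup>2 / (16 * v)\<close>. The assumption \<open>mL\<close>
    is exactly \<theta> L \<le> 1.\<close>
  define \<theta> where "\<theta> = m / (4 * v)"
  have \<theta>: "0 \<le> \<theta>" "\<theta> * L \<le> 1" using m v mL by (auto simp: \<theta>_def field_simps)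
  have meas [measurable]: "Z n \<in> borel_measurable M" if "n < N" for n
    using ind that unfolding indep_vars_def by auto
  let ?g = "\<lambda>n \<omega>. exp (- (\<theta> * Z n \<omega>))"
  note mgf = mgf_le_of_bounded[OF meas bnd var \<theta>]
  have ind': "indep_vars (\<lambda>_. borel) ?g {..<N}"
    by (rule indep_vars_compose2[OF ind, where Y = "\<lambda>_ z. exp (- (\<theta> * z))"]) simp
  have int: "integrable M (\<lambda>\<omega>. \<Prod>n<N. ?g n \<omega>)"
    by (rule indep_vars_integrable[OF _ ind']) (auto intro: mgf)
  have "expectation (\<lambda>\<omega>. \<Prod>n<N. ?g n \<omega>) = (\<Prod>n<N. expectation (?g n))"
    by (rule indep_vars_lebesgue_integral[OF _ ind']) (auto intro: mgf)
  also have "\<dots> \<le> (\<Prod>n<N. exp (- \<theta> * m + \<theta>\<^sup>2 * v))"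
    using mgf(2) by (intro prod_mono) (auto simp: mean)
  also have "\<dots> = exp (real N * (- \<theta> * m + \<theta>\<^sup>2 * v))"
    by (simp add: exp_of_nat_mult)
  finally have E: "expectation (\<lambda>\<omega>. \<Prod>n<N. ?g n \<omega>) \<le> exp (real N * (- \<theta> * m + \<theta>\<^sup>2 * v))" .
  let ?c = "exp (- (\<theta> * (real N * m / 2)))"
  have "{\<omega> \<in> space M. (\<Sum>n<N. Z n \<omega>) \<le> real N * m / 2} \<subseteq> {\<omega> \<in> space M. ?c \<le> (\<Prod>n<N. ?g n \<omega>)}"
  proof clarify
    fix \<omega> assume "(\<Sum>n<N. Z n \<omega>) \<le> real N * m / 2"
    from mult_left_mono[OF this \<theta>(1)]
    show "?c \<le> (\<Prod>n<N. ?g n \<omega>)"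
      by (simp add: exp_sum[symmetric] sum_negf sum_distrib_left)
  qed
  moreover have "{\<omega> \<in> space M. ?c \<le> (\<Prod>n<N. ?g n \<omega>)} \<in> events"
    using int by measurable
  ultimately have "prob {\<omega> \<in> space M. (\<Sum>n<N. Z n \<omega>) \<le> real N * m / 2} \<le>
      prob {\<omega> \<in> space M. ?c \<le> (\<Prod>n<N. ?g n \<omega>)}"
    by (rule finite_measure_mono)
  also have "\<dots> \<le> expectation (\<lambda>\<omega>. \<Prod>n<N. ?g n \<omega>) / ?c"
    by (rule integral_Markov_inequality_measure[OF int, where A = "{}"]) (auto intro!: AE_I2 prod_nonneg)
  also have "\<dots> \<le> exp (real N * (- \<theta> * m + \<theta>\<^sup>2 * v)) / ?c"
    using E by (intro divide_right_mono) auto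
  also have "\<dots> = exp (real N * (- \<theta> * m + \<theta>\<^sup>2 * v) + \<theta> * (real N * m / 2))"
    by (simp add: exp_diff[symmetric])
  also have "real N * (- \<theta> * m + \<theta>\<^sup>2 * v) + \<theta> * (real N * m / 2) = - (real N * m\<^sup>2 / (16 * v))"
    using v by (simp add: \<theta>_def field_simps power2_eq_square)
  finally show ?thesis .
qed

section \<open>Nets of subsets of the unit ball\<close>

text \<open>Cut space into cubes of side h = \<eta> / sqrt d and choose one point of S from each
  cube that meets S; points of one cube are within \<eta>. Choosing them in S matters because the
  tail bound will be available only there.\<close>

lemma unit_ball_net:
  fixes S :: "(real^'d::finite) set"
  assumes S: "\<And>v. v \<in> S \<Longrightarrow> norm v \<le> 1" and \<eta>: "0 < \<eta>" "\<eta> \<le> 1"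
  obtains W where "finite W" "W \<subseteq> S" "real (card W) \<le> (5 * sqrt (real CARD('d)) / \<eta>) ^ CARD('d)"
    "\<And>v. v \<in> S \<Longrightarrow> \<exists>w\<in>W. norm (v - w) \<le> \<eta>"
proof -
  define h where "h = \<eta> / sqrt (real CARD('d))"
  have sd: "1 \<le> sqrt (real CARD('d))" by (simp add: Suc_leI)
  have h: "0 < h" "h \<le> 1"
    using \<eta> order_trans[OF \<eta>(2) sd] by (auto simp: h_def)
  define cell where "cell v = (\<lambda>i. \<lfloor>v $ i / h\<rfloor>)" for v :: "real^'d"
  define m where "m = \<lceil>1 / h\<rceil>"
  define rep where "rep c = (SOME v. v \<in> S \<and> cell v = c)" for c
  define W where "W = rep ` cell ` S"
  have rep: "rep (cell v) \<in> S \<and> cell (rep (cell v)) = cell v" if "v \<in> S" for v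
    unfolding rep_def by (rule someI[of _ v]) (use that in auto)
  have sub: "cell ` S \<subseteq> PiE UNIV (\<lambda>_. {-m..m})"
  proof clarify
    fix v assume "v \<in> S"
    then have "\<bar>v $ i\<bar> \<le> 1" for i using S component_le_norm_cart[of v i] by (meson order_trans)
    then have b: "- (1 / h) \<le> v $ i / h" "v $ i / h \<le> 1 / h" for i
      using h(1) by (auto simp: field_simps abs_le_iff)
    have "-m \<le> \<lfloor>v $ i / h\<rfloor> \<and> \<lfloor>v $ i / h\<rfloor> \<le> m" for i
      using b[of i] unfolding m_def by (simp add: le_floor_iff) linarith
    then show "cell v \<in> PiE UNIV (\<lambda>_. {-m..m})" by (auto simp: cell_def)
  qed
  have finP: "finite (PiE (UNIV :: 'd set) (\<lambda>_. {-m..m}))" by (intro finite_PiE) auto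
  have fin: "finite (cell ` S)" using finite_subset[OF sub finP] .
  have "card W \<le> card (cell ` S)" unfolding W_def by (rule card_image_le[OF fin])
  also have "\<dots> \<le> card (PiE (UNIV :: 'd set) (\<lambda>_. {-m..m}))" by (rule card_mono[OF finP sub])
  also have "\<dots> = nat (2 * m + 1) ^ CARD('d)" by (simp add: card_PiE algebra_simps)
  finally have "real (card W) \<le> real (nat (2 * m + 1)) ^ CARD('d)"
    by (metis of_nat_le_iff of_nat_power)
  also have "\<dots> \<le> (5 / h) ^ CARD('d)"
  proof (rule power_mono)
    \<comment> \<open>As h \<le> 1, the count 2 m + 1 \<le> 2 / h + 3 of cells per axis is at most 5
      / h.\<close>
    have h1: "1 \<le> 1 / h" using h by simp
    then have "0 \<le> m" unfolding m_def by linarith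
    moreover have "real_of_int m \<le> 1 / h + 1" unfolding m_def by linarith
    moreover note h1
    ultimately show "real (nat (2 * m + 1)) \<le> 5 / h" by simp
  qed simp
  also have "5 / h = 5 * sqrt (real CARD('d)) / \<eta>" by (simp add: h_def)
  finally have card: "real (card W) \<le> (5 * sqrt (real CARD('d)) / \<eta>) ^ CARD('d)" .
  have near: "\<exists>w\<in>W. norm (v - w) \<le> \<eta>" if v: "v \<in> S" for v
  proof (intro bexI)
    let ?w = "rep (cell v)"
    show "?w \<in> W" using v by (auto simp: W_def)
    have c: "\<bar>(v - ?w) $ i\<bar> \<le> h" for i
    proof -
      have "\<lfloor>v $ i / h\<rfloor> = \<lfloor>?w $ i / h\<rfloor>" using rep[OF v] unfolding cell_def by metis
      then have "\<bar>v $ i / h - ?w $ i / h\<bar> \<le> 1" by linarith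
      then show ?thesis using h by (simp add: diff_divide_distrib[symmetric])
    qed
    have "(norm (v - ?w))\<^sup>2 = (\<Sum>i\<in>UNIV. ((v - ?w) $ i)\<^sup>2)"
      by (simp add: norm_vec_def L2_set_def sum_nonneg)
    also have "\<dots> \<le> (\<Sum>i\<in>(UNIV :: 'd set). h\<^sup>2)"
      using c h by (intro sum_mono) (metis abs_le_square_iff abs_of_pos)
    also have "\<dots> = \<eta>\<^sup>2" by (simp add: h_def power_divide)
    finally show "norm (v - ?w) \<le> \<eta>" using \<eta> by (simp add: power2_le_iff_abs_le)
  qed
  show ?thesis
    by (rule that[of W]) (use fin rep card near in \<open>auto simp: W_def\<close>)
qed

section \<open>From boundary comparison to local maxima\<close>

text \<open>The compact cap has a maximiser. If it lies on the boundary, the centre \<phi> does at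
  least as well and is itself an interior maximiser.\<close>

lemma interior_maximum_of_cap:
  fixes \<phi> :: "real^'d::finite" and Q :: "real^'d \<Rightarrow> real"
  assumes "norm \<phi> = 1" "0 < r" "continuous_on UNIV Q"
    and bdry: "\<And>p. norm p = 1 \<Longrightarrow> norm (p - \<phi>) = r \<Longrightarrow> Q p \<le> Q \<phi>"
  shows "\<exists>p. norm p = 1 \<and> norm (p - \<phi>) < r \<and> (\<forall>p'. norm p' = 1 \<longrightarrow> norm (p' - \<phi>) \<le> r \<longrightarrow> Q p' \<le> Q p)"
proof -
  let ?C = "sphere 0 1 \<inter> cball \<phi> r"
  have "compact ?C" "?C \<noteq> {}" using assms by (auto simp: compact_Int intro!: exI[of _ \<phi>])
  then obtain p where p: "p \<in> ?C" "\<And>p'. p' \<in> ?C \<Longrightarrow> Q p' \<le> Q p"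
    using continuous_attains_sup[of ?C Q] assms(3) continuous_on_subset by (metis subset_UNIV)
  have all: "Q p' \<le> Q p" if "norm p' = 1" "norm (p' - \<phi>) \<le> r" for p'
    using p(2)[of p'] that by (simp add: dist_norm norm_minus_commute)
  have p': "norm p = 1" "norm (p - \<phi>) \<le> r"
    using p(1) by (auto simp: dist_norm norm_minus_commute)
  show ?thesis
  proof (cases "norm (p - \<phi>) = r")
    case True
    then have "Q p \<le> Q \<phi>" using bdry p' by simp
    then show ?thesis using assms(1,2) all by (intro exI[of _ \<phi>]) (auto intro: order_trans)
  next
    case False
    then show ?thesis using p' all by (intro exI[of _ p]) auto
  qed
qed

text \<open>A sum of functions of separate atoms is maximised by maximising each over its own cap.
  Interior maximisers ensure that nearby dictionaries stay in the region where F splits.\<close>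

lemma local_max_if_decoupled:
  fixes \<Phi> :: "'k::finite \<Rightarrow> real^'d::finite" and Q :: "'k \<Rightarrow> real^'d \<Rightarrow> real"
  assumes unit: "\<And>k. norm (\<Phi> k) = 1" and r: "0 < r"
    and cont: "\<And>k. continuous_on UNIV (Q k)"
    and bdry: "\<And>k p. norm p = 1 \<Longrightarrow> norm (p - \<Phi> k) = r \<Longrightarrow> Q k p \<le> Q k (\<Phi> k)"
    and F: "\<And>\<Psi>. (\<And>k. norm (\<Psi> k - \<Phi> k) \<le> r) \<Longrightarrow> F \<Psi> = (\<Sum>k\<in>UNIV. Q k (\<Psi> k))"
  shows "\<exists>\<Psi>. local_max_on_dict F \<Psi> \<and> (\<forall>k. norm (\<Psi> k - \<Phi> k) \<le> r)"
proof -
  have "\<forall>k. \<exists>p. norm p = 1 \<and> norm (p - \<Phi> k) < r \<and>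
      (\<forall>p'. norm p' = 1 \<longrightarrow> norm (p' - \<Phi> k) \<le> r \<longrightarrow> Q k p' \<le> Q k p)"
    using interior_maximum_of_cap[OF unit r cont bdry] by blast
  then obtain \<Psi>0 where P: "\<And>k. norm (\<Psi>0 k) = 1" "\<And>k. norm (\<Psi>0 k - \<Phi> k) < r"
      "\<And>k p'. norm p' = 1 \<Longrightarrow> norm (p' - \<Phi> k) \<le> r \<Longrightarrow> Q k p' \<le> Q k (\<Psi>0 k)"
    by (metis (no_types, lifting))
  \<comment> \<open>The smallest remaining distance to the boundary among the finitely many caps,
    positive because all maximisers are interior.\<close>
  define \<epsilon> where "\<epsilon> = Min (range (\<lambda>k. r - norm (\<Psi>0 k - \<Phi> k)))"
  have \<epsilon>: "0 < \<epsilon>" "\<And>k. \<epsilon> \<le> r - norm (\<Psi>0 k - \<Phi> k)"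
    using P(2) by (auto simp: \<epsilon>_def)
  have "F \<Psi> \<le> F \<Psi>0" if "\<Psi> \<in> dictionaries" and near: "\<And>k. dist (\<Psi> k) (\<Psi>0 k) < \<epsilon>" for \<Psi>
  proof -
    have in_ball: "norm (\<Psi> k - \<Phi> k) \<le> r" for k
      using norm_triangle_ineq[of "\<Psi> k - \<Psi>0 k" "\<Psi>0 k - \<Phi> k"] near[of k] \<epsilon>(2)[of k]
      by (simp add: dist_norm)
    have "F \<Psi> = (\<Sum>k\<in>UNIV. Q k (\<Psi> k))" using F in_ball by blast
    also have "\<dots> \<le> (\<Sum>k\<in>UNIV. Q k (\<Psi>0 k))"
      using that(1) in_ball by (intro sum_mono P(3)) (auto simp: dictionaries_def)
    also have "\<dots> = F \<Psi>0" using F P(2) less_imp_le by metis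
    finally show ?thesis .
  qed
  then have "local_max_on_dict F \<Psi>0"
    unfolding local_max_on_dict_def using P(1) \<epsilon>(1) by (auto simp: dictionaries_def)
  then show ?thesis using P(2) less_imp_le by blast
qed

section \<open>Choice of the radius\<close>

text \<open>Serves to absorb a factor \<open>K\<^sup>2\<close> of the net count into a power with
  exponent k - 2.\<close>

lemma square_le_four_power:
  assumes "2 \<le> k" shows "(real k)\<^sup>2 \<le> 4 * 4 ^ (k - 2)"
  using assms
proof (induction k rule: dec_induct)
  case (step n)
  have "real (Suc n) \<le> 2 * real n" using step by simp
  from power_mono[OF this, of 2] have "(real (Suc n))\<^sup>2 \<le> 4 * (real n)\<^sup>2"
    by (simp add: power_mult_distrib)
  also have "\<dots> \<le> 4 * (4 * 4 ^ (n - 2))" using step by simp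
  also have "\<dots> = 4 * 4 ^ (Suc n - 2)" using step by (metis Suc_diff_le power_Suc mult.assoc)
  finally show ?case .
qed simp

text \<open>Here \<open>\<gamma> = 1 - 2\<beta>\<close>, \<open>B\<^sup>2 = C\<^sub>L\<close>, \<open>a = N powr - q\<close>, and \<open>s2 = 1 - \<langle>\<phi>, w\<rangle>\<^sup>2\<close> for unit vectors
  \<open>\<phi>, w\<close> at distance \<open>r\<close>. The second term in the minimum keeps the perturbed atoms
  in the region where the dominant coefficient still determines the largest correlation.\<close>

locale sample_size =
  fixes k d N :: nat and K A B \<gamma> lam a r s2 :: real
  assumes k: "2 \<le> k" and K: "K = real k" and d: "1 \<le> d" and A: "A = K / real d" "1 \<le> A"
    and B: "sqrt A \<le> B" "B \<le> sqrt A + 1/2"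
    and \<gamma>: "0 < \<gamma>" "\<gamma> \<le> 1" and lam: "0 < lam" "lam \<le> 1"
    and a: "0 < a" "a \<le> \<gamma>\<^sup>2 / (8 * A)" "1 \<le> a ^ 4 * real N"
    and r: "r = min (2 * a) (\<gamma> / (3 * sqrt K * B))"
    and s2: "s2 = r\<^sup>2 - r ^ 4 / 4"
begin

lemma K_ge: "2 \<le> K" using k K by simp

lemma B_ge: "1 \<le> B" using B(1) A(2) real_sqrt_ge_one[of A] by linarith

lemma B_square: "B\<^sup>2 \<le> 9/4 * A"
proof -
  have "B \<le> 3/2 * sqrt A" using B(2) A(2) real_sqrt_ge_one[of A] by linarith
  from power_mono[OF this, of 2] show ?thesis using B_ge A(2) by (simp add: power_mult_distrib power_divide)
qed

lemma a_le: "a \<le> 1/8"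
proof -
  have "\<gamma>\<^sup>2 / (8 * A) \<le> 1 / 8"
    using A(2) \<gamma> by (intro frac_le) (auto simp: power_le_one)
  then show ?thesis using a(2) by linarith
qed

lemma r_pos: "0 < r" using a(1) \<gamma>(1) K_ge B_ge unfolding r by simp

lemma rB_le_gamma: "r * B * (3 * sqrt K) \<le> \<gamma>"
proof -
  have "r \<le> \<gamma> / (3 * sqrt K * B)" unfolding r by simp
  then show ?thesis using K_ge B_ge by (simp add: pos_le_divide_eq mult_ac)
qed

lemma rB_le: "r * B \<le> 1/4"
proof -
  \<comment> \<open>Hence 3 sqrt K \<ge> 4, and \<gamma> \<le> 1 turns the radius constraint into
    the bound 1/4.\<close>
  have "4/3 \<le> sqrt K" using K_ge by (intro real_le_rsqrt) (simp add: power_divide)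
  then have "r * B * 4 \<le> r * B * (3 * sqrt K)"
    using r_pos B_ge by (intro mult_left_mono) auto
  then show ?thesis using rB_le_gamma \<gamma> by linarith
qed

lemma r_le: "r \<le> 1/4"
proof -
  have "r * 1 \<le> r * B" using r_pos B_ge by (intro mult_left_mono) auto
  then show ?thesis using rB_le by linarith
qed

lemma r_square_le: "r\<^sup>2 \<le> r * B"
  unfolding power2_eq_square using r_pos r_le B_ge by (intro mult_left_mono) linarith+

text \<open>With r \<le> 1/4 the correction \<open>r ^ 4 / 4\<close> is at most
  \<open>r\<^sup>2 / 64\<close>.\<close>

lemma s2_bounds: "63/64 * r\<^sup>2 \<le> s2" "s2 \<le> r\<^sup>2" "0 < s2"
proof -
  have "r\<^sup>2 \<le> (1/4)\<^sup>2" using r_le r_pos by (intro power_mono) auto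
  then have "r\<^sup>2 * r\<^sup>2 \<le> r\<^sup>2 * (1/16)" by (intro mult_left_mono) (auto simp: power_divide)
  moreover have "r ^ 4 = r\<^sup>2 * r\<^sup>2" by (simp add: power4_eq_xxxx power2_eq_square)
  ultimately show 1: "63/64 * r\<^sup>2 \<le> s2" unfolding s2 by linarith
  show "s2 \<le> r\<^sup>2" unfolding s2 by simp
  have "0 < r\<^sup>2" using r_pos by simp
  then show "0 < s2" using 1 by linarith
qed

text \<open>Lower bound on the radius behind the tail exponent; the cases are the two terms of the
  minimum. In the second, \<open>r\<^sup>2 * K\<close> is of order
  \<open>\<gamma>\<^sup>2 / A\<close>, and one factor a of \<open>a ^ 4\<close> supplies the same
  quantity. The constant 44 is large enough for 169 / 44 \<le> 4 (63/64)^2.\<close>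

lemma r_square_K: "44 * a ^ 4 \<le> r\<^sup>2 * K"
proof (cases "r = 2 * a")
  case True
  have "a\<^sup>2 \<le> (1/8)\<^sup>2" using a_le a(1) by (intro power_mono) auto
  then have "44 * (a\<^sup>2 * a\<^sup>2) \<le> 44 * (a\<^sup>2 * (1/64))"
    by (intro mult_left_mono) (auto simp: power_divide)
  also have "\<dots> \<le> 4 * a\<^sup>2 * 2" by simp
  also have "\<dots> \<le> 4 * a\<^sup>2 * K" using K_ge by (intro mult_left_mono) auto
  finally show ?thesis using True by (simp add: power_mult_distrib power_add[symmetric])
next
  case False
  then have r': "r = \<gamma> / (3 * sqrt K * B)" unfolding r by (simp add: min_def split: if_splits)
  have "a ^ 3 \<le> (1/8) ^ 3" using a_le a(1) by (intro power_mono) auto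
  then have "a * a ^ 3 \<le> \<gamma>\<^sup>2 / (8 * A) * (1/8) ^ 3" using a A(2) by (intro mult_mono) auto
  moreover have "a ^ 4 = a * a ^ 3" by (simp add: power_Suc[symmetric] del: power_Suc)
  ultimately have "44 * a ^ 4 \<le> 44/4096 * (\<gamma>\<^sup>2 / A)" by (simp add: power_divide)
  also have "\<dots> \<le> 4/81 * (\<gamma>\<^sup>2 / A)" using A(2) by (intro mult_right_mono) auto
  also have "\<dots> = \<gamma>\<^sup>2 / (9 * (9/4 * A))" by simp
  also have "\<dots> \<le> \<gamma>\<^sup>2 / (9 * B\<^sup>2)"
    using B_square B_ge A(2) by (intro divide_left_mono) auto
  also have "\<dots> = r\<^sup>2 * K" using K_ge B_ge unfolding r' by (simp add: power_divide power_mult_distrib)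
  finally show ?thesis .
qed

text \<open>The right side is the Bernstein exponent for mean s2 \<lambda> / K, range L and second
  moment \<open>L\<^sup>2 / K\<close>. As 16 (13/4)^2 = 169, the comparison reduces to
  \<open>key\<close>. The 1 / K in the second moment leaves only a single K on the larger side of
  \<open>key\<close>.\<close>

lemma tail_exponent:
  defines "L \<equiv> 13/4 * (r * B)"
  shows "a ^ 4 * real N * lam\<^sup>2 / (4 * K\<^sup>2 * B\<^sup>2) \<le> real N * (s2 * lam / K)\<^sup>2 / (16 * (L\<^sup>2 / K))"
    and "s2 * lam / K * L \<le> 4 * (L\<^sup>2 / K)" and "0 < L\<^sup>2 / K"
proof -
  have L: "0 < L" using r_pos B_ge by (simp add: L_def)
  show "0 < L\<^sup>2 / K" using L K_ge by simp
  have "s2 * lam \<le> s2 * 1" using s2_bounds(3) lam by (intro mult_left_mono) auto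
  also have "\<dots> \<le> 4 * L" using s2_bounds(2) r_square_le mult_pos_pos[of r B] r_pos B_ge unfolding L_def by linarith
  finally have "s2 * lam * L \<le> 4 * L * L" using L by (intro mult_right_mono) auto
  then show "s2 * lam / K * L \<le> 4 * (L\<^sup>2 / K)"
    using K_ge by (simp add: divide_right_mono power2_eq_square mult_ac)
  have "169 * a ^ 4 * r\<^sup>2 \<le> (169/44 * (r\<^sup>2 * K)) * r\<^sup>2"
    using r_square_K by (intro mult_right_mono) (linarith, simp)
  also have "\<dots> \<le> 4 * (63/64)\<^sup>2 * (r\<^sup>2 * K) * r\<^sup>2"
    using K_ge by (intro mult_right_mono) (auto simp: power_divide)
  also have "\<dots> = 4 * K * (63/64 * r\<^sup>2)\<^sup>2" by (simp add: power2_eq_square)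
  also have "\<dots> \<le> 4 * K * s2\<^sup>2"
    using s2_bounds(1) K_ge by (intro mult_left_mono power_mono) auto
  finally have key: "169 * a ^ 4 * r\<^sup>2 \<le> 4 * K * s2\<^sup>2" .
  have "a ^ 4 * real N * lam\<^sup>2 / (4 * K\<^sup>2 * B\<^sup>2) = real N * lam\<^sup>2 * (169 * a ^ 4 * r\<^sup>2) / (4 * K\<^sup>2 * (169 * r\<^sup>2 * B\<^sup>2))"
    using r_pos by (simp add: field_simps)
  also have "\<dots> \<le> real N * lam\<^sup>2 * (4 * K * s2\<^sup>2) / (4 * K\<^sup>2 * (169 * r\<^sup>2 * B\<^sup>2))"
    using key by (intro divide_right_mono mult_left_mono) auto
  also have "\<dots> = real N * (s2 * lam / K)\<^sup>2 / (16 * (L\<^sup>2 / K))"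
    using K_ge r_pos B_ge by (simp add: L_def field_simps power2_eq_square)
  finally show "a ^ 4 * real N * lam\<^sup>2 / (4 * K\<^sup>2 * B\<^sup>2) \<le> real N * (s2 * lam / K)\<^sup>2 / (16 * (L\<^sup>2 / K))" .
qed

text \<open>Controls how fine the net must be. In the case where the second term of the minimum is
  active, \<open>8 * a\<^sup>2 \<le> 8 * a \<le> \<gamma>\<^sup>2\<close> trades \<gamma> for
  a.\<close>

lemma inverse_r_square: "1 / r\<^sup>2 \<le> 9/8 * K * B\<^sup>2 / a\<^sup>2"
proof (cases "r = 2 * a")
  case True
  have "1 \<le> K * B\<^sup>2" using mult_mono[of 1 K 1 "B\<^sup>2"] K_ge B_ge by simp
  then show ?thesis using True a(1) by (simp add: power_mult_distrib divide_right_mono field_simps)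
next
  case False
  then have r': "r = \<gamma> / (3 * sqrt K * B)" unfolding r by (simp add: min_def split: if_splits)
  have "a\<^sup>2 \<le> a" using a_le a(1) by (simp add: power2_eq_square mult_left_le)
  also have "8 * a \<le> \<gamma>\<^sup>2"
  proof -
    have "\<gamma>\<^sup>2 / (8 * A) \<le> \<gamma>\<^sup>2 / 8" using A(2) by (intro divide_left_mono) auto
    then show ?thesis using a(2) by simp
  qed
  finally have g: "8 * a\<^sup>2 \<le> \<gamma>\<^sup>2" by simp
  have "1 / r\<^sup>2 = 9 * K * B\<^sup>2 / \<gamma>\<^sup>2"
    using K_ge unfolding r' by (simp add: power_divide power_mult_distrib)
  also have "\<dots> \<le> 9 * K * B\<^sup>2 / (8 * a\<^sup>2)"
    using g a(1) K_ge \<gamma> by (intro divide_left_mono) auto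
  finally show ?thesis by simp
qed

lemma N_ge: "4096 \<le> real N"
proof -
  have "a ^ 4 \<le> (1/8) ^ 4" using a_le a(1) by (intro power_mono) auto
  then have "a ^ 4 * real N \<le> (1/8) ^ 4 * real N" by (intro mult_right_mono) auto
  then show ?thesis using a(3) by (simp add: power_divide)
qed

lemma T_ge: "real N \<le> real N * K * B\<^sup>2 / lam"
proof -
  have "1 * 1 \<le> K * B\<^sup>2" using K_ge B_ge by (intro mult_mono) auto
  then have "1 \<le> K * B\<^sup>2 / lam" using lam by (simp add: pos_le_divide_eq)
  from mult_left_mono[OF this, of "real N"] show ?thesis by simp
qed

lemma d_le: "real d \<le> K"
proof -
  have "1 * real d \<le> A * real d" using A(2) by (intro mult_right_mono) auto
  then show ?thesis using A(1) d by simp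
qed

text \<open>This \<eta> solves \<open>2 * B\<^sup>2 * \<eta> = (s2 * lam / K) / 2\<close>: rounding
  to the net may cost half of the expected decrease.\<close>

lemma resolution:
  defines "\<eta> \<equiv> s2 * lam / (4 * K * B\<^sup>2)"
  shows "0 < \<eta>" "\<eta> \<le> 1"
proof -
  show "0 < \<eta>" using s2_bounds lam K_ge B_ge by (simp add: \<eta>_def)
  have "s2 \<le> 1" using s2_bounds(2) r_square_le rB_le by linarith
  then have "s2 * lam \<le> 1 * 1" using s2_bounds lam by (intro mult_mono) auto
  also have "\<dots> \<le> (4 * K) * B\<^sup>2" using K_ge B_ge by (intro mult_mono) auto
  finally show "\<eta> \<le> 1" using K_ge B_ge by (simp add: \<eta>_def)
qed

text \<open>Counts the net points of all K atoms. With T = N K B^2 / \<lambda>, the base times K is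
  at most T^k, so the d-th power is at most T^(k d).\<close>

lemma net_size:
  defines "\<eta> \<equiv> s2 * lam / (4 * K * B\<^sup>2)"
  shows "K * (5 * sqrt (real d) / \<eta>) ^ d \<le> exp (K * real d * ln (real N * K * B\<^sup>2 / lam))"
proof -
  define T where "T = real N * K * B\<^sup>2 / lam"
  have T: "4096 \<le> T" "real N \<le> T" using T_ge N_ge by (auto simp: T_def)
  have "sqrt (real d) \<le> K"
  proof -
    have "real d \<le> K * K" using d_le K_ge mult_mono[of 1 K "real d" K] by simp
    then show ?thesis using K_ge by (intro real_le_lsqrt) (auto simp: power2_eq_square)
  qed
  then have "5 * sqrt (real d) / \<eta> \<le> 5 * K / \<eta>"
    using resolution by (intro divide_right_mono) (auto simp: \<eta>_def)
  also have "\<dots> = 20 * K\<^sup>2 * B\<^sup>2 / lam * (1 / s2)" by (simp add: \<eta>_def power2_eq_square mult_ac)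
  also have "\<dots> \<le> 20 * K\<^sup>2 * B\<^sup>2 / lam * (8/7 * K * B\<^sup>2 / a\<^sup>2)"
  proof (rule mult_left_mono)
    have "1 / s2 \<le> 1 / (63/64 * r\<^sup>2)" using s2_bounds r_pos by (intro divide_left_mono) auto
    also have "\<dots> = 64/63 * (1 / r\<^sup>2)" by simp
    also have "\<dots> \<le> 64/63 * (9/8 * K * B\<^sup>2 / a\<^sup>2)" using inverse_r_square by (intro mult_left_mono) auto
    finally show "1 / s2 \<le> 8/7 * K * B\<^sup>2 / a\<^sup>2" by simp
  qed (use K_ge lam in auto)
  also have "\<dots> = K * (160/7 * (K\<^sup>2 * B ^ 4 / lam / a\<^sup>2))"
    by (simp add: field_simps power2_eq_square power4_eq_xxxx)
  \<comment> \<open>Passing from \<lambda> to its square, possible as \<lambda> \<le> 1, makes the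
    square of T appear.\<close>
  also have "\<dots> \<le> K * (23 * (K\<^sup>2 * B ^ 4 / lam\<^sup>2 / a\<^sup>2))"
  proof -
    have "lam\<^sup>2 \<le> lam" using lam by (simp add: power2_eq_square mult_left_le)
    then have "K\<^sup>2 * B ^ 4 / lam \<le> K\<^sup>2 * B ^ 4 / lam\<^sup>2" using lam by (intro divide_left_mono) auto
    then have "K\<^sup>2 * B ^ 4 / lam / a\<^sup>2 \<le> K\<^sup>2 * B ^ 4 / lam\<^sup>2 / a\<^sup>2" by (intro divide_right_mono) auto
    moreover have "0 \<le> K\<^sup>2 * B ^ 4 / lam / a\<^sup>2" using lam by simp
    ultimately have "160/7 * (K\<^sup>2 * B ^ 4 / lam / a\<^sup>2) \<le> 23 * (K\<^sup>2 * B ^ 4 / lam\<^sup>2 / a\<^sup>2)"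
      by (intro mult_mono) auto
    then show ?thesis using K_ge by (intro mult_left_mono) auto
  qed
  also have "K\<^sup>2 * B ^ 4 / lam\<^sup>2 / a\<^sup>2 = T\<^sup>2 / ((real N)\<^sup>2 * a\<^sup>2)"
    using N_ge lam a(1) by (simp add: T_def power_divide power_mult_distrib)
  finally have "K * (5 * sqrt (real d) / \<eta>) \<le> K * (K * (23 * (T\<^sup>2 / ((real N)\<^sup>2 * a\<^sup>2))))"
    using K_ge by (intro mult_left_mono) auto
  also have "\<dots> = K\<^sup>2 * (23 * (T\<^sup>2 / ((real N)\<^sup>2 * a\<^sup>2)))" by (simp add: power2_eq_square)
  \<comment> \<open>The denominator \<open>(real N)\<^sup>2 * a\<^sup>2\<close> is at least N \<ge>
    4096, which beats the numerical factor 4 times 23.\<close>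
  also have "\<dots> \<le> (4 * 4 ^ (k - 2)) * (23 * (T\<^sup>2 / 4096))"
  proof (intro mult_mono)
    show "K\<^sup>2 \<le> 4 * 4 ^ (k - 2)" unfolding K by (rule square_le_four_power[OF k])
    have "a ^ 4 \<le> a\<^sup>2" using a_le a(1) by (intro power_decreasing) auto
    then have "a ^ 4 * real N \<le> a\<^sup>2 * real N" by (intro mult_right_mono) auto
    then have "1 \<le> a\<^sup>2 * real N" using a(3) by linarith
    then have "real N * 1 \<le> real N * (a\<^sup>2 * real N)" by (intro mult_left_mono) auto
    also have "\<dots> = (real N)\<^sup>2 * a\<^sup>2" by (simp add: power2_eq_square)
    finally have "4096 \<le> (real N)\<^sup>2 * a\<^sup>2" using N_ge by linarith
    then show "T\<^sup>2 / ((real N)\<^sup>2 * a\<^sup>2) \<le> T\<^sup>2 / 4096" by (intro divide_left_mono) auto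
  qed auto
  also have "\<dots> \<le> 4 ^ (k - 2) * T\<^sup>2" by (simp add: mult_left_mono)
  also have "\<dots> \<le> T ^ (k - 2) * T\<^sup>2" using T by (intro mult_right_mono power_mono) auto
  also have "\<dots> = T ^ k" using k by (metis power_add le_add_diff_inverse2)
  finally have main: "K * (5 * sqrt (real d) / \<eta>) \<le> T ^ k" .
  have "0 \<le> 5 * sqrt (real d) / \<eta>"
    unfolding \<eta>_def by (intro divide_nonneg_nonneg less_imp_le[OF resolution(1)]) auto
  \<comment> \<open>The outer K moves inside the power because K \<le> K^d.\<close>
  then have "K * (5 * sqrt (real d) / \<eta>) ^ d \<le> (K * (5 * sqrt (real d) / \<eta>)) ^ d"
    unfolding power_mult_distrib using self_le_power[of K d] K_ge d by (intro mult_right_mono zero_le_power) auto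
  also have "\<dots> \<le> (T ^ k) ^ d" 
    by (intro power_mono main mult_nonneg_nonneg) (use K_ge \<open>0 \<le> 5 * sqrt (real d) / \<eta>\<close> in auto)
  also have "\<dots> = T ^ (k * d)" by (simp add: power_mult)
  also have "\<dots> = exp (ln T) ^ (k * d)" using T by simp
  also have "\<dots> = exp (K * real d * ln T)" by (simp add: exp_of_nat_mult[symmetric] K)
  finally show ?thesis unfolding T_def .
qed

end

section \<open>Finite sample recovery\<close>

theorem theorem7:
  fixes \<Phi> :: "'k::finite \<Rightarrow> real^'d::finite"
    and M :: "'a measure"
    and \<nu> :: "(real^'k) measure"
    and X :: "nat \<Rightarrow> 'a \<Rightarrow> real^'k"
    and R :: "nat \<Rightarrow> 'a \<Rightarrow> real^'d"
    and N :: nat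
    and A \<mu> \<rho> \<rho>max c1bar \<beta> q lam CL :: real
  assumes K2: "CARD('k) \<ge> 2"
    and A_def: "A = real CARD('k) / real CARD('d)"
    and frame: "unit_norm_tight_frame \<Phi> A"
    and mu_def: "\<mu> = coherence \<Phi>"
    and P: "prob_space M"
    and N1: "N \<ge> 1"
    and indep: "prob_space.indep_vars M (\<lambda>_. borel) (\<lambda>n \<omega>. (X n \<omega>, R n \<omega>)) {..<N}"
    and indep_xr: "\<And>n. n < N \<Longrightarrow> prob_space.indep_set M (sets (vimage_algebra (space M) (X n) borel))
          (sets (vimage_algebra (space M) (R n) borel))"
    and Xdist: "\<And>n. n < N \<Longrightarrow> distr M borel (X n) = \<nu>"
    and Rdist: "\<And>n. n < N \<Longrightarrow> distr M borel (R n) = distr M borel (R 0)"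
    and Rbound: "\<And>n. n < N \<Longrightarrow> (AE \<omega> in M. norm (R n \<omega>) \<le> \<rho>max)"
    and Rmean: "\<And>n. n < N \<Longrightarrow> integral\<^sup>L M (R n) = 0"
    and Rcov: "\<And>n i j. n < N \<Longrightarrow>
        integral\<^sup>L M (\<lambda>\<omega>. R n \<omega> $ i * R n \<omega> $ j) = (if i = j then \<rho>^2 else 0)"
    and nu_prob: "prob_space \<nu>"
    and nu_sets: "sets \<nu> = sets borel"
    and nu_sphere: "\<nu> (sphere 0 1) = 1"
    and nu_sym: "symmetric_measure \<nu>"
    and c1bar: "integral\<^sup>L \<nu> (\<lambda>x. (linf_norm x)^2) = c1bar^2"
    and beta: "\<beta> < 1/2"
    and gap: "measure \<nu> {x \<in> space \<nu>. rearr x 2 < rearr x 1 \<and>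
        (rearr x 2 + \<mu> * rearr_l1 x + \<rho>max) / (rearr x 1 - rearr x 2) \<le> \<beta>} = 1"
    and lambda_def: "lam = c1bar^2 - (1 - c1bar^2) / (real CARD('k) - 1)"
    and CL_def: "CL = (sqrt A + \<rho>max)^2"
    and q: "0 < q" "q < 1/4"
    and Nsamples: "real N powr (-q) + real N powr (-2*q) / real CARD('k)
        \<le> (1 - 2*\<beta>)^2 / (4 * A * ln (4 * A * real CARD('k) / lam))"
  shows "\<exists>E \<in> sets M.
     measure M E \<le> exp (- (real N powr (1 - 4*q) * lam^2) / (4 * (real CARD('k))^2 * CL)
        + real CARD('k) * real CARD('d) * ln (real N * real CARD('k) * CL / lam)) \<and>
     (\<forall>\<omega> \<in> space M - E.
        \<exists>\<Psi>. local_max_on_dict (emp_objective N (\<lambda>n. synth \<Phi> (X n \<omega>) + R n \<omega>)) \<Psi> \<and>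
             (\<forall>k. norm (\<Psi> k - \<Phi> k) \<le> 2 * real N powr (-q)))"
proof -
  interpret prob_space M by (rule P)
  define K where "K = real CARD('k)"
  define B where "B = sqrt A + \<rho>max"
  define a where "a = real N powr (- q)"
  have K2': "2 \<le> K" using K2 by (simp add: K_def)
  have A1: "1 \<le> A" using tight_frame_constant_ge_1[OF frame] .
  have unit: "norm (\<Phi> k) = 1" for k using unit_norm_tight_frameD(1)[OF frame] .
  have mu0: "0 \<le> \<mu>"
  proof -
    obtain i j :: 'k where "i \<noteq> j"
      using K2 card_le_Suc0_iff_eq[of "UNIV :: 'k set"] by auto
    then show ?thesis using abs_inner_le_coherence[of i j \<Phi>] abs_ge_zero[of "\<Phi> i \<bullet> \<Phi> j"] unfolding mu_def by linarith
  qed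
  have pair [measurable]: "(\<lambda>\<omega>. (X n \<omega>, R n \<omega>)) \<in> borel_measurable M" if "n < N" for n
    using indep that unfolding indep_vars_def by auto
  have X [measurable]: "X n \<in> borel_measurable M" if "n < N" for n
    using measurable_compose[OF pair[OF that], of fst borel]
      borel_measurable_continuous_onI[OF continuous_on_fst[OF continuous_on_id]] by simp
  have R [measurable]: "R n \<in> borel_measurable M" if "n < N" for n
    using measurable_compose[OF pair[OF that], of snd borel]
      borel_measurable_continuous_onI[OF continuous_on_snd[OF continuous_on_id]] by simp

  \<comment> \<open>Consequences of the gap condition for \<nu>\<close>
  interpret nu0: prob_space \<nu> by (rule nu_prob)
  have unit_x: "AE x in \<nu>. norm x = 1"
  proof -
    have "measure \<nu> (sphere 0 1) = 1" using nu_sphere by (simp add: measure_def)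
    from nu0.AE_prob_1[OF this] show ?thesis by eventually_elim simp
  qed
  have sep_x: "AE x in \<nu>. \<exists>k. separated \<mu> \<rho>max \<beta> x k"
    using nu0.AE_prob_1[OF gap] unit_x
    by eventually_elim (auto intro!: separated_if_gap[OF K2 mu0])
  have rho0: "0 \<le> \<rho>max"
  proof (rule ccontr)
    assume neg: "\<not> 0 \<le> \<rho>max"
    have "AE \<omega> in M. False"
      using Rbound[OF less_le_trans[OF zero_less_one N1]]
    proof eventually_elim
      case (elim \<omega>)
      then show ?case using neg norm_ge_zero[of "R 0 \<omega>"] by linarith
    qed
    then show False by simp
  qed
  note sepD = mu0 rho0 beta
  \<comment> \<open>An almost sure property has a witness; its existence forces the purely numerical
    bounds on \<open>\<rho>max\<close> and \<beta>.\<close>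
  obtain x0 :: "real^'k" and k0 where x0: "separated \<mu> \<rho>max \<beta> x0 k0"
  proof (rule ccontr)
    assume "\<not> thesis"
    then have none: "\<not> separated \<mu> \<rho>max \<beta> x k" for x :: "real^'k" and k using that by blast
    have "AE x in \<nu>. False" using sep_x by eventually_elim (use none in blast)
    then show False by simp
  qed
  have rho_half: "\<rho>max \<le> 1/2" by (rule separated_noise_le[OF x0 sepD])
  have beta0: "0 \<le> \<beta>" by (rule separated_beta_nonneg[OF x0 sepD])
  have nu: "dominant_symmetric \<nu>"
  proof
    show "AE x in \<nu>. \<exists>k. x \<in> dominant k"
      using sep_x by eventually_elim (auto intro: separated_dominant[OF _ sepD])
  qed (use nu_sets nu_sym unit_x K2 in auto)
  have linf_bounds: "AE x in \<nu>. 9 / (K + 8) \<le> (linf_norm x)\<^sup>2 \<and> (linf_norm x)\<^sup>2 \<le> 1"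
    using sep_x
  proof eventually_elim
    case (elim x)
    then obtain k where k: "separated \<mu> \<rho>max \<beta> x k" by blast
    have "(linf_norm x)\<^sup>2 = (x $ k)\<^sup>2" by (simp add: linf_norm_dominant[OF separated_dominant[OF k sepD]])
    moreover have "(x $ k)\<^sup>2 \<le> 1" using separated_max_le_1[OF k sepD] by (simp add: abs_square_le_1)
    ultimately show ?case using separated_max_ge[OF k sepD] by (simp add: K_def)
  qed
  have linf_int: "integrable \<nu> (\<lambda>x. (linf_norm x)\<^sup>2)"
  proof (rule nu0.integrable_const_bound[where B = 1])
    show "(\<lambda>x. (linf_norm x)\<^sup>2) \<in> borel_measurable \<nu>"
      unfolding measurable_cong_sets[OF nu_sets refl] by measurable
  qed (use linf_bounds in auto)
  have c1_le: "c1bar\<^sup>2 \<le> 1"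
    using nu0.integral_le_const[OF linf_int, of 1] linf_bounds unfolding c1bar by auto
  have c1_ge: "9 / (K + 8) \<le> c1bar\<^sup>2"
    using nu0.integral_ge_const[OF linf_int, of "9 / (K + 8)"] linf_bounds unfolding c1bar by auto
  have lam_le: "lam \<le> 1"
    using c1_le K2' unfolding lambda_def K_def[symmetric] by (smt (verit) divide_nonneg_nonneg)
  \<comment> \<open>Here \<lambda> = (K c - 1) / (K - 1) with c = \<open>c1bar\<^sup>2\<close>, and
    K c \<ge> 9 K / (K + 8) > 1 as K \<ge> 2.\<close>
  have lam_pos: "0 < lam"
  proof -
    have "1 < K * (9 / (K + 8))" using K2' by (simp add: field_simps)
    also have "\<dots> \<le> K * c1bar\<^sup>2" using c1_ge K2' by (intro mult_left_mono) auto
    finally have "0 < (K * c1bar\<^sup>2 - 1) / (K - 1)" using K2' by simp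
    also have "(K * c1bar\<^sup>2 - 1) / (K - 1) = lam"
      using K2' unfolding lambda_def K_def[symmetric] by (simp add: field_simps)
    finally show ?thesis .
  qed

  \<comment> \<open>Radius and sample size\<close>
  have N0: "0 < real N" using N1 by simp
  \<comment> \<open>The argument is at least 8, which exceeds the square of e. The bound 2 turns the
    sample condition into \<open>a \<le> (1 - 2 * \<beta>)\<^sup>2 / (8 * A)\<close>.\<close>
  have ln_ge: "2 \<le> ln (4 * A * K / lam)"
  proof -
    have "1 * 2 \<le> A * K" using A1 K2' by (intro mult_mono) auto
    then have "8 \<le> 4 * A * K / 1" by simp
    also have "\<dots> \<le> 4 * A * K / lam" using lam_pos lam_le A1 K2' by (intro divide_left_mono) auto
    finally have "8 \<le> 4 * A * K / lam" .
    moreover have "exp (2::real) \<le> 8"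
    proof -
      have "exp (2::real) = exp 1 * exp 1" by (simp add: exp_add[symmetric])
      also have "\<dots> \<le> (272/100) * (272/100)" using e_less_272 by (intro mult_mono) auto
      finally show ?thesis by simp
    qed
    ultimately show ?thesis by (subst ln_ge_iff) linarith+
  qed
  have a_le: "a \<le> (1 - 2 * \<beta>)\<^sup>2 / (8 * A)"
  proof -
    have "a \<le> a + real N powr (-2*q) / K" using K2' by simp
    also have "\<dots> \<le> (1 - 2*\<beta>)\<^sup>2 / (4 * A * ln (4 * A * K / lam))"
      using Nsamples unfolding a_def K_def .
    also have "\<dots> \<le> (1 - 2*\<beta>)\<^sup>2 / (4 * A * 2)"
      using ln_ge A1 by (intro divide_left_mono mult_left_mono) auto
    finally show ?thesis by simp
  qed
  have a4: "a ^ 4 * real N = real N powr (1 - 4 * q)"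
  proof -
    have "a ^ 4 = real N powr (- (4 * q))"
      unfolding a_def using N0 by (simp add: powr_realpow[symmetric] powr_powr mult.commute)
    then show ?thesis using N0 by (simp add: powr_diff powr_minus field_simps)
  qed
  define r where "r = min (2 * a) ((1 - 2 * \<beta>) / (3 * sqrt K * B))"
  define s2 where "s2 = r\<^sup>2 - r ^ 4 / 4"
  interpret S: sample_size "CARD('k)" "CARD('d)" N K A B "1 - 2 * \<beta>" lam a r s2
  proof
    show "1 \<le> a ^ 4 * real N" unfolding a4 using q N1 by (simp add: ge_one_powr_ge_zero)
  qed (use K2 A_def A1 rho0 rho_half beta beta0 lam_pos lam_le a_le N0 in
      \<open>auto simp: K_def B_def a_def r_def s2_def Suc_leI\<close>)
  \<comment> \<open>\<open>m\<close> will be the mean of \<open>Z\<close>, \<open>L\<close> its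
    range, and \<eta> the resolution of the net on the boundary \<open>C k\<close> of the
    cap.\<close>
  define m where "m = s2 * lam / K"
  define L where "L = 13/4 * (r * B)"
  define \<eta> where "\<eta> = s2 * lam / (4 * K * B\<^sup>2)"
  define C where "C k = {w. norm w = 1 \<and> norm (w - \<Phi> k) = r}" for k
  define y where "y n \<omega> = synth \<Phi> (X n \<omega>) + R n \<omega>" for n \<omega>
  \<comment> \<open>The gain of \<phi>_k over w on sample n; a nonnegative sum over n says that the
    empirical form of atom k is not larger at w.\<close>
  define Z where "Z k w n \<omega> = indicator (dominant k) (X n \<omega>) * ((\<Phi> k \<bullet> y n \<omega>)\<^sup>2 - (w \<bullet> y n \<omega>)\<^sup>2)" for k w n \<omega>
  define good where "good \<omega> \<longleftrightarrow> (\<forall>n<N. norm (R n \<omega>) \<le> \<rho>max \<and> (\<exists>k. separated \<mu> \<rho>max \<beta> (X n \<omega>) k))" for \<omega>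
  have AE_sep: "AE \<omega> in M. norm (R n \<omega>) \<le> \<rho>max \<and> (\<exists>k. separated \<mu> \<rho>max \<beta> (X n \<omega>) k)" if "n < N" for n
  proof -
    have "AE \<omega> in M. \<exists>k. separated \<mu> \<rho>max \<beta> (X n \<omega>) k"
      using sep_x unfolding Xdist[OF that, symmetric] by (rule AE_distrD[OF X[OF that]])
    then show ?thesis using Rbound[OF that] by eventually_elim auto
  qed
  have AE_good: "AE \<omega> in M. good \<omega>"
  proof -
    have "AE \<omega> in M. \<forall>n\<in>{..<N}. norm (R n \<omega>) \<le> \<rho>max \<and> (\<exists>k. separated \<mu> \<rho>max \<beta> (X n \<omega>) k)"
      using AE_sep by (intro AE_ball_countable') auto
    then show ?thesis by eventually_elim (auto simp: good_def)
  qed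

  \<comment> \<open>Mean, range and second moment of the differences\<close>
  have moment: "integrable M (\<lambda>\<omega>. indicator (dominant k) (X n \<omega>) * (u \<bullet> y n \<omega>)\<^sup>2)"
      "expectation (\<lambda>\<omega>. indicator (dominant k) (X n \<omega>) * (u \<bullet> y n \<omega>)\<^sup>2) =
        (lam * (\<Phi> k \<bullet> u)\<^sup>2 + ((1 - c1bar\<^sup>2) / (K - 1) * A + \<rho>\<^sup>2) * (norm u)\<^sup>2) / K"
      and prob_k: "expectation (\<lambda>\<omega>. indicator (dominant k) (X n \<omega>)) = 1 / K" if "n < N" for n k u
  proof -
    note model = X[OF that] R[OF that] Xdist[OF that] nu indep_xr[OF that] Rbound[OF that]
      Rmean[OF that] Rcov[OF that] frame
    show "integrable M (\<lambda>\<omega>. indicator (dominant k) (X n \<omega>) * (u \<bullet> y n \<omega>)\<^sup>2)"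
      unfolding y_def by (rule signal_quadratic_moment(1)[OF model])
    show "expectation (\<lambda>\<omega>. indicator (dominant k) (X n \<omega>) * (u \<bullet> y n \<omega>)\<^sup>2) =
        (lam * (\<Phi> k \<bullet> u)\<^sup>2 + ((1 - c1bar\<^sup>2) / (K - 1) * A + \<rho>\<^sup>2) * (norm u)\<^sup>2) / K"
      unfolding y_def lambda_def K_def c1bar[symmetric] by (rule signal_quadratic_moment(2)[OF model])
    show "expectation (\<lambda>\<omega>. indicator (dominant k) (X n \<omega>)) = 1 / K"
      unfolding K_def by (rule expectation_indicator_dominant[OF model])
  qed
  have mean: "expectation (Z k w n) = m" if n: "n < N" and w: "w \<in> C k" for k w n
  proof -
    have "expectation (Z k w n) = expectation (\<lambda>\<omega>. indicator (dominant k) (X n \<omega>) * (\<Phi> k \<bullet> y n \<omega>)\<^sup>2) -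
        expectation (\<lambda>\<omega>. indicator (dominant k) (X n \<omega>) * (w \<bullet> y n \<omega>)\<^sup>2)"
      using moment(1)[OF n] unfolding Z_def[abs_def] right_diff_distrib by simp
    \<comment> \<open>Both vectors have norm 1, so the terms depending only on the norm
      cancel.\<close>
    also have "\<dots> = lam * (1 - (\<Phi> k \<bullet> w)\<^sup>2) / K"
      unfolding moment(2)[OF n] using w unit[of k]
      by (simp add: C_def dot_square_norm diff_divide_distrib[symmetric] algebra_simps)
    also have "1 - (\<Phi> k \<bullet> w)\<^sup>2 = s2"
      unfolding s2_def using one_minus_inner_square_on_cap_boundary[of w "\<Phi> k" r] w unit[of k] by (simp add: C_def)
    finally show ?thesis by (simp add: m_def mult.commute)
  qed
  have bounded: "\<bar>Z k w n \<omega>\<bar> \<le> L * indicator (dominant k) (X n \<omega>)"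
    if Rn: "norm (R n \<omega>) \<le> \<rho>max" and sepn: "\<exists>k. separated \<mu> \<rho>max \<beta> (X n \<omega>) k" and w: "w \<in> C k" for k w n \<omega>
  proof (cases "X n \<omega> \<in> dominant k")
    case True
    obtain l where l: "separated \<mu> \<rho>max \<beta> (X n \<omega>) l" using sepn by blast
    have "l = k" using dominant_unique[OF separated_dominant[OF l sepD] True] .
    then have sep: "separated (coherence \<Phi>) \<rho>max \<beta> (X n \<omega>) k" using l mu_def by simp
    note sig = frame sep mu0[unfolded mu_def] Rn beta
    have "\<bar>(w - \<Phi> k) \<bullet> y n \<omega>\<bar> \<le> norm (w - \<Phi> k) * norm (y n \<omega>)" by (rule Cauchy_Schwarz_ineq2)
    also have "\<dots> \<le> r * B"
      using w norm_signal_le[OF sig] S.r_pos by (intro mult_mono) (auto simp: C_def y_def B_def)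
    finally have 1: "\<bar>(w - \<Phi> k) \<bullet> y n \<omega>\<bar> \<le> r * B" .
    \<comment> \<open>Writing w + \<phi> as (w - \<phi>) + 2 \<phi> brings in the bound 3/2 on the
      dominant correlation: the total is 1/4 + 3, in place of the cruder 2 B.\<close>
    have "(w + \<Phi> k) \<bullet> y n \<omega> = (w - \<Phi> k) \<bullet> y n \<omega> + 2 * (\<Phi> k \<bullet> y n \<omega>)"
      by (simp add: inner_diff_left inner_add_left)
    then have 2: "\<bar>(w + \<Phi> k) \<bullet> y n \<omega>\<bar> \<le> 13/4"
      using 1 S.rB_le abs_inner_dominant_atom_le[OF sig] unfolding y_def by linarith
    have "(\<Phi> k \<bullet> y n \<omega>)\<^sup>2 - (w \<bullet> y n \<omega>)\<^sup>2 = - (((w - \<Phi> k) \<bullet> y n \<omega>) * ((w + \<Phi> k) \<bullet> y n \<omega>))"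
      by (simp add: inner_diff_left inner_add_left power2_eq_square algebra_simps)
    then have "\<bar>(\<Phi> k \<bullet> y n \<omega>)\<^sup>2 - (w \<bullet> y n \<omega>)\<^sup>2\<bar> \<le> (r * B) * (13/4)"
      using mult_mono[OF 1 2] S.r_pos S.B_ge by (simp add: abs_mult)
    then show ?thesis using True by (simp add: Z_def L_def)
  qed (simp add: Z_def)
  have Zmeas [measurable]: "Z k w n \<in> borel_measurable M" if "n < N" for k w n
    using moment(1)[OF that] unfolding Z_def[abs_def] right_diff_distrib by (intro borel_measurable_diff) auto
  have L_pos: "0 < L" using S.r_pos S.B_ge by (simp add: L_def)
  have bnd: "AE \<omega> in M. \<bar>Z k w n \<omega>\<bar> \<le> L" if n: "n < N" and w: "w \<in> C k" for k w n
    using AE_sep[OF n]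
  proof eventually_elim
    case (elim \<omega>)
    then show ?case using bounded[of n \<omega> w k] w L_pos
      by (cases "X n \<omega> \<in> dominant k") auto
  qed
  \<comment> \<open>The indicator is kept in the pointwise bound, so integration gains the
    probability 1 / K of dominance.\<close>
  have var: "expectation (\<lambda>\<omega>. (Z k w n \<omega>)\<^sup>2) \<le> L\<^sup>2 / K" if n: "n < N" and w: "w \<in> C k" for k w n
  proof -
    have le: "AE \<omega> in M. (Z k w n \<omega>)\<^sup>2 \<le> L\<^sup>2 * indicator (dominant k) (X n \<omega>)"
      using AE_sep[OF n]
    proof eventually_elim
      case (elim \<omega>)
      then have "\<bar>Z k w n \<omega>\<bar>\<^sup>2 \<le> (L * indicator (dominant k) (X n \<omega>))\<^sup>2"
        using bounded[of n \<omega> w k] w by (intro power_mono) auto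
      then show ?case by (cases "X n \<omega> \<in> dominant k") (auto simp: power_mult_distrib)
    qed
    have int: "integrable M (\<lambda>\<omega>. L\<^sup>2 * indicator (dominant k) (X n \<omega>))"
      using n by (intro integrable_const_bound[where B = "L\<^sup>2"]) (auto simp: indicator_def)
    have "expectation (\<lambda>\<omega>. (Z k w n \<omega>)\<^sup>2) \<le> expectation (\<lambda>\<omega>. L\<^sup>2 * indicator (dominant k) (X n \<omega>))"
      using le n by (intro integral_mono_AE' int) auto
    also have "\<dots> = L\<^sup>2 / K" using prob_k[OF n] by simp
    finally show ?thesis .
  qed

  \<comment> \<open>The exceptional event and its probability\<close>
  define e where "e = exp (- (real N powr (1 - 4*q) * lam\<^sup>2) / (4 * K\<^sup>2 * CL))"
  define Bad where "Bad k w = {\<omega> \<in> space M. (\<Sum>n<N. Z k w n \<omega>) \<le> real N * m / 2}" for k w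
  have Bad_sets [measurable]: "Bad k w \<in> sets M" for k w
    unfolding Bad_def by measurable
  have Bad_prob: "prob (Bad k w) \<le> e" if w: "w \<in> C k" for k w
  proof -
    have ind: "indep_vars (\<lambda>_. borel) (Z k w) {..<N}"
    proof -
      \<comment> \<open>\<open>Z\<close> is one fixed Borel function of the pair of X_n and R_n, so
        it inherits independence over n.\<close>
      let ?f = "\<lambda>p :: (real^'k) \<times> (real^'d). indicator (dominant k) (fst p) *
        ((\<Phi> k \<bullet> (synth \<Phi> (fst p) + snd p))\<^sup>2 - (w \<bullet> (synth \<Phi> (fst p) + snd p))\<^sup>2) :: real"
      have "?f \<in> borel_measurable borel"
        unfolding borel_prod[symmetric] by measurable
      from indep_vars_compose2[OF indep, of "\<lambda>_. ?f" "\<lambda>_. borel"] this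
      show ?thesis by (simp add: Z_def[abs_def] y_def)
    qed
    have "prob (Bad k w) \<le> exp (- (real N * m\<^sup>2 / (16 * (L\<^sup>2 / K))))"
      unfolding Bad_def
      by (rule bernstein_half_mean[OF ind, where L = L])
        (use bnd mean var w S.tail_exponent S.s2_bounds lam_pos K2' in
          \<open>auto simp: m_def L_def\<close>)
    also have "\<dots> \<le> e"
      using S.tail_exponent(1) unfolding e_def a4 m_def L_def CL_def B_def by simp
    finally show ?thesis .
  qed
  have "\<exists>W. finite W \<and> W \<subseteq> C k \<and> real (card W) \<le> (5 * sqrt (real CARD('d)) / \<eta>) ^ CARD('d) \<and>
      (\<forall>v\<in>C k. \<exists>w\<in>W. norm (v - w) \<le> \<eta>)" for k
    by (rule unit_ball_net[of "C k" \<eta>]) (use S.resolution in \<open>auto simp: C_def \<eta>_def\<close>)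
  then obtain W where W: "\<And>k. finite (W k)" "\<And>k. W k \<subseteq> C k"
      "\<And>k. real (card (W k)) \<le> (5 * sqrt (real CARD('d)) / \<eta>) ^ CARD('d)"
      "\<And>k v. v \<in> C k \<Longrightarrow> \<exists>w\<in>W k. norm (v - w) \<le> \<eta>"
    by metis
  \<comment> \<open>A measurable null set covering all outcomes with an unseparated coefficient
    vector or excessive noise.\<close>
  obtain N0 where N0: "{\<omega> \<in> space M. \<not> good \<omega>} \<subseteq> N0" "emeasure M N0 = 0" "N0 \<in> sets M"
    using AE_good by (rule AE_E)
  define Ev where "Ev = N0 \<union> (\<Union>k. \<Union>w\<in>W k. Bad k w)"
  have Ev_sets: "Ev \<in> sets M"
    unfolding Ev_def using N0 W(1) by (intro sets.Un sets.finite_UN) auto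
  have "prob Ev \<le> prob N0 + prob (\<Union>k. \<Union>w\<in>W k. Bad k w)"
    unfolding Ev_def using N0 W(1) by (intro measure_Un_le sets.finite_UN) auto
  also have "prob N0 = 0" using N0 by (simp add: measure_def)
  also have "prob (\<Union>k. \<Union>w\<in>W k. Bad k w) \<le> (\<Sum>k\<in>UNIV. prob (\<Union>w\<in>W k. Bad k w))"
    using W(1) by (intro finite_measure_subadditive_finite) (auto intro!: sets.finite_UN)
  also have "\<dots> \<le> (\<Sum>k\<in>(UNIV :: 'k set). (5 * sqrt (real CARD('d)) / \<eta>) ^ CARD('d) * e)"
  proof (rule sum_mono)
    fix k
    have "prob (\<Union>w\<in>W k. Bad k w) \<le> (\<Sum>w\<in>W k. prob (Bad k w))"
      using W(1) by (intro finite_measure_subadditive_finite) auto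
    also have "\<dots> \<le> (\<Sum>w\<in>W k. e)" using W(2) Bad_prob by (intro sum_mono) auto
    also have "\<dots> = real (card (W k)) * e" by simp
    also have "\<dots> \<le> (5 * sqrt (real CARD('d)) / \<eta>) ^ CARD('d) * e"
      using W(3) by (intro mult_right_mono) (auto simp: e_def)
    finally show "prob (\<Union>w\<in>W k. Bad k w) \<le> (5 * sqrt (real CARD('d)) / \<eta>) ^ CARD('d) * e" .
  qed
  also have "\<dots> = e * (K * (5 * sqrt (real CARD('d)) / \<eta>) ^ CARD('d))" by (simp add: K_def)
  also have "\<dots> \<le> e * exp (K * real CARD('d) * ln (real N * K * B\<^sup>2 / lam))"
    using S.net_size unfolding \<eta>_def by (intro mult_left_mono) (auto simp: e_def)
  also have "\<dots> = exp (- (real N powr (1 - 4*q) * lam^2) / (4 * (real CARD('k))^2 * CL)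
        + real CARD('k) * real CARD('d) * ln (real N * real CARD('k) * CL / lam))"
    unfolding e_def exp_add K_def CL_def B_def ..
  finally have prob_Ev: "prob Ev \<le> exp (- (real N powr (1 - 4*q) * lam^2) / (4 * (real CARD('k))^2 * CL)
        + real CARD('k) * real CARD('d) * ln (real N * real CARD('k) * CL / lam))" by simp

  \<comment> \<open>A local maximum off the exceptional event\<close>
  have "\<exists>\<Psi>. local_max_on_dict (emp_objective N (\<lambda>n. synth \<Phi> (X n \<omega>) + R n \<omega>)) \<Psi> \<and>
      (\<forall>k. norm (\<Psi> k - \<Phi> k) \<le> 2 * real N powr (-q))" if \<omega>: "\<omega> \<in> space M - Ev" for \<omega>
  proof -
    have "good \<omega>" using \<omega> N0(1) unfolding Ev_def by auto
    then have Rn: "norm (R n \<omega>) \<le> \<rho>max" and sepn: "\<exists>k. separated \<mu> \<rho>max \<beta> (X n \<omega>) k" if "n < N" for n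
      using that unfolding good_def by auto
    have ynorm: "norm (y n \<omega>) \<le> B" if n: "n < N" for n
    proof -
      obtain k where "separated (coherence \<Phi>) \<rho>max \<beta> (X n \<omega>) k" using sepn[OF n] mu_def by auto
      from norm_signal_le[OF frame this mu0[unfolded mu_def] Rn[OF n] beta] show ?thesis
        by (simp add: y_def B_def)
    qed
    define Q where "Q k p = 1 / real N * (\<Sum>n<N. indicator (dominant k) (X n \<omega>) * (p \<bullet> y n \<omega>)\<^sup>2)" for k p
    have "\<exists>\<Psi>. local_max_on_dict (emp_objective N (\<lambda>n. y n \<omega>)) \<Psi> \<and> (\<forall>k. norm (\<Psi> k - \<Phi> k) \<le> r)"
    proof (rule local_max_if_decoupled[where Q = Q])
      show "continuous_on UNIV (Q k)" for k
        unfolding Q_def[abs_def] by (intro continuous_intros)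
      show "Q k p \<le> Q k (\<Phi> k)" if p: "norm p = 1" "norm (p - \<Phi> k) = r" for k p
      proof -
        have "p \<in> C k" using p by (simp add: C_def)
        then obtain w where w: "w \<in> W k" "norm (p - w) \<le> \<eta>" using W(4) by blast
        have wC: "norm w = 1" using w(1) W(2) by (auto simp: C_def)
        have "\<omega> \<notin> Bad k w" using \<omega> w(1) unfolding Ev_def by auto
        then have Zge: "real N * m / 2 \<le> (\<Sum>n<N. Z k w n \<omega>)" using \<omega> unfolding Bad_def by auto
        have "(\<Sum>n<N. indicator (dominant k) (X n \<omega>) * (p \<bullet> y n \<omega>)\<^sup>2) \<le>
            (\<Sum>n<N. indicator (dominant k) (X n \<omega>) * (w \<bullet> y n \<omega>)\<^sup>2 + 2 * B\<^sup>2 * \<eta>)"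
        proof (rule sum_mono)
          fix n assume "n \<in> {..<N}"
          then have d: "\<bar>(p \<bullet> y n \<omega>)\<^sup>2 - (w \<bullet> y n \<omega>)\<^sup>2\<bar> \<le> 2 * B\<^sup>2 * \<eta>"
            using abs_diff_inner_squares_le[OF w(2) ynorm p(1) wC] by auto
          have "0 \<le> 2 * B\<^sup>2 * \<eta>" using d by linarith
          then show "indicator (dominant k) (X n \<omega>) * (p \<bullet> y n \<omega>)\<^sup>2 \<le>
              indicator (dominant k) (X n \<omega>) * (w \<bullet> y n \<omega>)\<^sup>2 + 2 * B\<^sup>2 * \<eta>"
            using d by (cases "X n \<omega> \<in> dominant k") auto
        qed
        \<comment> \<open>The rounding error \<open>2 * B\<^sup>2 * \<eta>\<close> per sample equals
          m / 2, exactly the margin guaranteed at the net point by \<open>Zge\<close>.\<close>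
        also have "\<dots> = (\<Sum>n<N. indicator (dominant k) (X n \<omega>) * (w \<bullet> y n \<omega>)\<^sup>2) + real N * m / 2"
          using S.B_ge by (simp add: sum.distrib \<eta>_def m_def mult.commute)
        also have "\<dots> \<le> (\<Sum>n<N. indicator (dominant k) (X n \<omega>) * (\<Phi> k \<bullet> y n \<omega>)\<^sup>2)"
          using Zge by (simp add: Z_def right_diff_distrib sum_subtractf)
        finally show ?thesis unfolding Q_def by (intro mult_left_mono) auto
      qed
      show "emp_objective N (\<lambda>n. y n \<omega>) \<Psi> = (\<Sum>k\<in>UNIV. Q k (\<Psi> k))"
        if near: "\<And>k. norm (\<Psi> k - \<Phi> k) \<le> r" for \<Psi>
      proof -
        have "(linf_norm (analysis_op \<Psi> (y n \<omega>)))\<^sup>2 =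
            (\<Sum>k\<in>UNIV. indicator (dominant k) (X n \<omega>) * (\<Psi> k \<bullet> y n \<omega>)\<^sup>2)" if n: "n < N" for n
        proof -
          obtain k where k: "separated (coherence \<Phi>) \<rho>max \<beta> (X n \<omega>) k" using sepn[OF n] mu_def by auto
          \<comment> \<open>The second term in the minimum defining r is what allows \<epsilon> = r
            here.\<close>
          have "linf_norm (analysis_op \<Psi> (y n \<omega>)) = \<bar>\<Psi> k \<bullet> y n \<omega>\<bar>"
            unfolding y_def
            by (rule linf_norm_near_frame[OF frame k mu0[unfolded mu_def] Rn[OF n] beta near])
              (use S.rB_le_gamma in \<open>simp add: B_def K_def\<close>)
          moreover have "X n \<omega> \<in> dominant k" using separated_dominant[OF k mu0[unfolded mu_def] rho0 beta] .
          ultimately show ?thesis using sum_indicator_dominant[of "X n \<omega>" k "\<lambda>k. (\<Psi> k \<bullet> y n \<omega>)\<^sup>2"] by simp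
        qed
        then have "emp_objective N (\<lambda>n. y n \<omega>) \<Psi> =
            1 / real N * (\<Sum>n<N. \<Sum>k\<in>UNIV. indicator (dominant k) (X n \<omega>) * (\<Psi> k \<bullet> y n \<omega>)\<^sup>2)"
          unfolding emp_objective_def by simp
        also have "\<dots> = (\<Sum>k\<in>UNIV. Q k (\<Psi> k))"
          unfolding Q_def sum_distrib_left[symmetric] by (subst sum.swap) simp
        finally show ?thesis .
      qed
    qed (use unit S.r_pos in auto)
    then obtain \<Psi> where \<Psi>: "local_max_on_dict (emp_objective N (\<lambda>n. y n \<omega>)) \<Psi>"
        "\<And>k. norm (\<Psi> k - \<Phi> k) \<le> r" by blast
    have "r \<le> 2 * real N powr (-q)" by (simp add: r_def a_def)
    then show ?thesis using \<Psi> order_trans unfolding y_def by blast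
  qed
  then show ?thesis using Ev_sets prob_Ev by blast
qed

end
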